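(* Let $G$ be a finite rank additive subgroup of $V=\mathbb{Q}^{\mathbb{N}}$ (equivalently, up to isomorphism, a torsion-free abelian group of finite rank). Then $G$ has only finitely many non-isomorphic direct summands; that is, the direct summands of $G$ fall into finitely many isomorphism classes.
   Context: A direct summand of $G$ is a subgroup $H\leq G$ such that $G=H\oplus K$ for some subgroup $K\leq G$. *)

theory Defs
  imports "HOL-Algebra.Algebra" "HOL-Library.Function_Algebras"
begin

definition rat_seq_group :: "(nat \<Rightarrow> rat) monoid"
  where "rat_seq_group = \<lparr>carrier = UNIV, monoid.mult = (+), one = 0\<rparr>"

lemma comm_group_rat_seq_group: "comm_group rat_seq_group"
proof (rule comm_groupI)
  fix x :: "nat \<Rightarrow> rat"
  show "\<exists>y\<in>carrier rat_seq_group. y \<otimes>\<^bsub>rat_seq_group\<^esub> x = \<one>\<^bsub>rat_seq_group\<^esub>"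
    by (rule bexI[of _ "- x"]) (simp_all add: rat_seq_group_def)
qed (simp_all add: rat_seq_group_def add.assoc add.commute)

global_interpretation rat_seq: vector_space "\<lambda>(q::rat) (x::nat \<Rightarrow> rat) n. q * x n"
  by standard (simp_all add: fun_eq_iff algebra_simps)

text \<open>
  The rank of an additive subgroup \<open>G\<close> is the size of a maximal linearly independent subset of \<open>G\<close>,
  i.e. of a basis contained in \<open>G\<close> of the rational vector space spanned by \<open>G\<close>. The library's
  \<open>dim\<close> cannot express finiteness, since it is a natural number also for infinite-dimensional
  spaces. For subsets of a rational vector space, independence over the integers
  and over the rationals coincide.
\<close>

definition finite_rank :: "(nat \<Rightarrow> rat) set \<Rightarrow> bool"
  where "finite_rank G \<longleftrightarrow>
    (\<exists>B. finite B \<and> B \<subseteq> G \<and> rat_seq.independent B \<and> G \<subseteq> rat_seq.span B)"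

text \<open>Internal direct sums, intended for abelian \<open>G\<close>; the zero subgroup and \<open>G\<close> itself are summands.\<close>

definition direct_summand :: "'a set \<Rightarrow> ('a, 'b) monoid_scheme \<Rightarrow> bool"
  where "direct_summand H G \<longleftrightarrow>
    subgroup H G \<and>
    (\<exists>K. subgroup K G \<and> H <#>\<^bsub>G\<^esub> K = carrier G \<and> H \<inter> K = {\<one>\<^bsub>G\<^esub>})"

definition direct_summands :: "('a, 'b) monoid_scheme \<Rightarrow> 'a set set"
  where "direct_summands G = {H. direct_summand H G}"

definition summand_iso_rel :: "('a, 'b) monoid_scheme \<Rightarrow> ('a set \<times> 'a set) set"
  where "summand_iso_rel G =
    {(H, K). H \<in> direct_summands G \<and> K \<in> direct_summands G \<and>
      G\<lparr>carrier := H\<rparr> \<cong> G\<lparr>carrier := K\<rparr>}"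

lemma equiv_summand_iso_rel:
  assumes "group G"
  shows "equiv (direct_summands G) (summand_iso_rel G)"
proof (rule equivI)
  show "summand_iso_rel G \<subseteq> direct_summands G \<times> direct_summands G"
    by (auto simp: summand_iso_rel_def)
  show "refl_on (direct_summands G) (summand_iso_rel G)"
    by (auto simp: refl_on_def summand_iso_rel_def)
  have "group (G\<lparr>carrier := H\<rparr>)" if "H \<in> direct_summands G" for H
    using that assms
    by (auto simp: direct_summands_def direct_summand_def intro: subgroup.subgroup_is_group)
  then show "sym (summand_iso_rel G)"
    by (auto simp: sym_def summand_iso_rel_def intro: group.iso_sym)
  show "trans (summand_iso_rel G)"
    unfolding trans_def summand_iso_rel_def using iso_trans by blast
qed

end

theory Submission
  imports Defs "Jordan_Normal_Form.Determinant"
begin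

text \<open>
  A direct summand of \<open>G\<close> is the image of an idempotent \<open>e\<close> of the endomorphism ring \<open>E\<close>, and two
  summands are isomorphic as soon as \<open>b * a = e\<close> and \<open>a * b = f\<close> for some \<open>a \<in> f E e\<close>,
  \<open>b \<in> e E f\<close>. The algebra \<open>A = \<rat> E\<close> is finite-dimensional, and it suffices to find such \<open>a\<close>, \<open>b\<close>
  modulo its nil radical \<open>J\<close>, because \<open>e\<close> plus a nilpotent element is invertible in \<open>e E e\<close>.

  Fix a finitely generated subring \<open>\<Lambda> \<subseteq> E\<close> with \<open>\<rat> \<Lambda> = A\<close>. Although \<open>E\<close> itself need not be finitely
  generated, the right \<open>\<Lambda>\<close>-modules \<open>e \<Lambda>\<close> are lattices, and an isomorphism \<open>e \<Lambda> \<cong> f \<Lambda>\<close> modulo \<open>J\<close> already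
  yields \<open>a\<close> and \<open>b\<close>. So only the finiteness theorem of Jordan and Zassenhaus for \<open>\<Lambda>\<close> is needed.
  Write \<open>1\<close> as a sum of primitive idempotents \<open>p\<close>. In the local algebra \<open>p A p\<close>, an element of minimal
  norm in a lattice generates it up to a bounded index, by Dirichlet's approximation argument. This splits off
  from every lattice \<open>M\<close>, modulo \<open>J\<close>, a copy of some \<open>p \<Lambda>\<close> up to a bounded index. Iterating,
  \<open>M\<close> becomes commensurable, with a bounded index, to a sum of at most \<open>dim A\<close> modules \<open>p \<Lambda>\<close>, which
  leaves finitely many possibilities.
\<close>

section \<open>Rational algebras and lattices\<close>

text \<open>All identities are congruences of elements modulo \<open>J\<close>; neither a quotient
  ring nor the structure theory of semisimple algebras enters. The obstacle is uniformity: for a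
  single lattice every denominator can be cleared, but finiteness needs one bound for all lattices
  at once. It comes from the norm form of a corner \<open>p A p\<close>, the determinant of left
  multiplication. On a lattice its values have a common denominator, so a nonnilpotent element of
  least norm exists; and the remainder in Dirichlet's approximation has norm below 1 as soon as its
  coordinates are below a threshold that depends on the basis of the corner alone. Minimality forces
  the product of the minimal element with this remainder to be nilpotent, hence to lie in
  \<open>J\<close>, because the corner is local. The multiplier in the approximation varies with the
  element, but it is bounded, and a factorial absorbs all its values. The way back to
  \<open>E\<close> rests on \<open>e\<close> lying in \<open>e \<Lambda>\<close>: a map of lattices
  sends it, modulo \<open>J\<close>, to some \<open>f x\<close> with
  \<open>x \<in> \<Lambda>\<close>, so the coefficient is in \<open>E\<close> although the map is
  given only by an element of \<open>A\<close>.\<close>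

definition nilp :: "'a::ring_1 \<Rightarrow> bool"
  where "nilp x \<longleftrightarrow> (\<exists>n. x ^ n = 0)"

text \<open>\<open>(y * x) ^ (n + 1) = y * (x * y) ^ n * x\<close>. This symmetry makes the
  one-sided definition of the radical two-sided.\<close>

lemma nilp_swap:
  fixes x y :: "'a::ring_1"
  assumes "nilp (x * y)"
  shows "nilp (y * x)"
proof -
  obtain n where n: "(x * y) ^ n = 0"
    using assms unfolding nilp_def by blast
  have "(y * x) ^ Suc n = y * (x * y) ^ n * x"
    by (induction n) (simp_all add: mult.assoc power_Suc2 del: power_Suc)
  then show ?thesis
    unfolding nilp_def using n by (intro exI[of _ "Suc n"]) simp
qed

text \<open>The finite geometric series inverts \<open>1 - z\<close>; multiplied by \<open>e\<close>
  it gives an inverse inside the corner of \<open>e\<close>, whose unit is \<open>e\<close> and not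
  \<open>1\<close>.\<close>

lemma geometric_inverse_corner:
  fixes e z :: "'a::ring_1"
  assumes e: "e * z = z" "z * e = z" "e * e = e" and z: "z ^ n = 0"
  defines "w \<equiv> e * (\<Sum>i<n. z ^ i)"
  shows "(e - z) * w = e" and "w * (e - z) = e"
proof -
  have "(1 - z) * (\<Sum>i<m. z ^ i) = 1 - z ^ m" for m
  proof (induction m)
    case (Suc m)
    then show ?case by (simp add: distrib_left left_diff_distrib)
  qed simp
  from this[of n] have 1: "(1 - z) * (\<Sum>i<n. z ^ i) = 1"
    using z by simp
  have comm: "z * (\<Sum>i<n. z ^ i) = (\<Sum>i<n. z ^ i) * z"
    by (simp add: sum_distrib_left sum_distrib_right power_commutes)
  then have 2: "(\<Sum>i<n. z ^ i) * (1 - z) = 1"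
    using 1 by (simp add: algebra_simps)
  have "(e - z) * w = e * ((1 - z) * (\<Sum>i<n. z ^ i))"
    unfolding w_def using e by (simp add: algebra_simps flip: mult.assoc)
  then show "(e - z) * w = e"
    using 1 by simp
  have ez: "e * z ^ i = z ^ i * e" for i
    using power_commuting_commutes[of z e i] e by simp
  have "w = (\<Sum>i<n. z ^ i) * e"
    unfolding w_def by (simp add: sum_distrib_left sum_distrib_right ez)
  then have "w * (e - z) = (\<Sum>i<n. z ^ i) * (1 - z) * e"
    using e by (simp add: algebra_simps)
  then show "w * (e - z) = e"
    using 2 by simp
qed

section \<open>Lattices in rational vector spaces\<close>

locale rat_vector_space = vector_space scale
  for scale :: "rat \<Rightarrow> 'a::ab_group_add \<Rightarrow> 'a" (infixr "*s" 75)
begin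

text \<open>A basis of \<open>U\<close> together with a vector of \<open>W\<close> outside
  \<open>U\<close> stays independent. The finite set \<open>F\<close> guarantees that
  \<open>dim\<close> is a true dimension here; the inequality drives the inductions over
  dimension.\<close>

lemma dim_strict_mono:
  assumes "finite F" "W \<subseteq> span F" "subspace U" "U \<subset> W"
  shows "dim U < dim W"
proof -
  obtain B where B: "B \<subseteq> U" "independent B" "U \<subseteq> span B" "card B = dim U"
    using basis_exists by blast
  obtain C where C: "C \<subseteq> W" "independent C" "W \<subseteq> span C" "card C = dim W"
    using basis_exists by blast
  have finC: "finite C"
    using independent_span_bound[OF assms(1) C(2)] C(1) assms(2) by auto
  obtain w where w: "w \<in> W" "w \<notin> U"
    using assms(4) by blast
  have "w \<notin> span B"
    using w(2) B(1) assms(3) span_minimal by blast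
  then have ind: "independent (insert w B)" and "w \<notin> B"
    using B(2) by (auto simp: independent_insert span_base)
  have "insert w B \<subseteq> span C"
    using w(1) B(1) C(3) assms(4) by auto
  note bound = independent_span_bound[OF finC ind this]
  then have "card (insert w B) = Suc (card B)"
    using \<open>w \<notin> B\<close> by simp
  then show ?thesis
    using bound B(4) C(4) by linarith
qed

text \<open>Meant for finite \<open>S\<close>: on an infinite index set the sum is 0 by
  convention.\<close>

definition zspan :: "'a set \<Rightarrow> 'a set"
  where "zspan S = range (\<lambda>c::'a \<Rightarrow> int. \<Sum>s\<in>S. of_int (c s) *s s)"

definition zmodule :: "'a set \<Rightarrow> bool"
  where "zmodule Z \<longleftrightarrow> 0 \<in> Z \<and> (\<forall>x\<in>Z. \<forall>y\<in>Z. x - y \<in> Z)"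

lemma zmodule_neg: "zmodule Z \<Longrightarrow> x \<in> Z \<Longrightarrow> - x \<in> Z"
  unfolding zmodule_def by (metis diff_0)

lemma zmodule_add: "zmodule Z \<Longrightarrow> x \<in> Z \<Longrightarrow> y \<in> Z \<Longrightarrow> x + y \<in> Z"
proof -
  assume Z: "zmodule Z" "x \<in> Z" "y \<in> Z"
  then have "x - (- y) \<in> Z"
    using zmodule_neg[OF Z(1,3)] unfolding zmodule_def by blast
  then show ?thesis by simp
qed

lemma zmodule_scale:
  assumes Z: "zmodule Z" and x: "x \<in> Z"
  shows "of_int n *s x \<in> Z"
proof -
  have nat: "of_nat m *s x \<in> Z" for m
  proof (induction m)
    case 0
    then show ?case using Z by (simp add: zmodule_def)
  next
    case (Suc m)
    then show ?case using Z x by (simp add: scale_left_distrib zmodule_add)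
  qed
  show ?thesis
  proof (cases n)
    case (nonneg m)
    then show ?thesis using nat[of m] by simp
  next
    case (neg m)
    have "of_int n *s x = - (of_nat (Suc m) *s x)"
      unfolding neg scale_minus_left[symmetric] by simp
    then show ?thesis using zmodule_neg[OF Z nat[of "Suc m"]] by metis
  qed
qed

lemma zmodule_sum: "zmodule Z \<Longrightarrow> (\<And>s. s \<in> S \<Longrightarrow> f s \<in> Z) \<Longrightarrow> sum f S \<in> Z"
  by (induction S rule: infinite_finite_induct) (auto simp: zmodule_add zmodule_def)

lemma zmodule_zspan: "zmodule (zspan S)"
  unfolding zmodule_def
proof (intro conjI ballI)
  show "0 \<in> zspan S"
    unfolding zspan_def by (rule range_eqI[of _ _ "\<lambda>_. 0"]) simp
  fix x y assume "x \<in> zspan S" "y \<in> zspan S"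
  then obtain c d where "x = (\<Sum>s\<in>S. of_int (c s) *s s)" "y = (\<Sum>s\<in>S. of_int (d s) *s s)"
    unfolding zspan_def by blast
  then have "x - y = (\<Sum>s\<in>S. of_int (c s - d s) *s s)"
    by (simp add: scale_left_diff_distrib sum_subtractf)
  then show "x - y \<in> zspan S"
    unfolding zspan_def by (rule range_eqI[where x = "\<lambda>s. c s - d s"])
qed

lemma zspan_base:
  assumes "finite S" "s \<in> S"
  shows "s \<in> zspan S"
proof -
  have "(\<Sum>t\<in>S. of_int (if t = s then 1 else 0) *s t) = (\<Sum>t\<in>S. if t = s then t else 0)"
    by (rule sum.cong) auto
  also have "\<dots> = s"
    using assms by simp
  finally show ?thesis
    unfolding zspan_def by (intro range_eqI[where x = "\<lambda>t. if t = s then 1 else 0"]) simp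
qed

lemma zspan_minimal:
  assumes "zmodule Z" "S \<subseteq> Z"
  shows "zspan S \<subseteq> Z"
  unfolding zspan_def image_subset_iff using assms by (intro ballI zmodule_sum zmodule_scale) auto

lemma zspan_subset_span: "zspan S \<subseteq> span S"
proof -
  have "(\<Sum>s\<in>S. of_int (c s) *s s) \<in> span S" for c :: "'a \<Rightarrow> int"
    by (rule span_sum) (rule span_scale, rule span_base)
  then show ?thesis
    unfolding zspan_def by blast
qed

text \<open>Multiply the finitely many individual multipliers. The function \<open>f\<close> is
  arbitrary so that families such as products of basis vectors are covered.\<close>

lemma common_multiple:
  assumes "finite S" and "\<And>s. s \<in> S \<Longrightarrow> \<exists>n::int. n > 0 \<and> of_int n *s f s \<in> Z" and "zmodule Z"
  shows "\<exists>n::int. n > 0 \<and> (\<forall>s\<in>S. of_int n *s f s \<in> Z)"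
  using assms(1,2)
proof (induction S)
  case empty
  then show ?case by (auto intro: exI[of _ 1])
next
  case (insert s S)
  obtain n :: int where n: "n > 0" "\<forall>t\<in>S. of_int n *s f t \<in> Z"
    using insert.IH insert.prems by blast
  obtain m :: int where m: "m > 0" "of_int m *s f s \<in> Z"
    using insert.prems by blast
  have "of_int (m * n) *s f t \<in> Z" if "t \<in> insert s S" for t
  proof (cases "t = s")
    case True
    then show ?thesis
      using zmodule_scale[OF assms(3) m(2), of n] by (simp add: mult.commute)
  next
    case False
    then show ?thesis
      using zmodule_scale[OF assms(3), of "of_int n *s f t" m] n that by simp
  qed
  then show ?case
    using n m by (intro exI[of _ "m * n"]) simp
qed

lemma zspan_bounded:
  assumes "finite S" and "\<And>x y. f (x + y) = f x + f y" and "\<And>q x. f (q *s x) = q *s f x"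
    and "zmodule Z" and "\<And>s. s \<in> S \<Longrightarrow> \<exists>n::int. n > 0 \<and> of_int n *s f s \<in> Z"
  shows "\<exists>n::int. n > 0 \<and> (\<forall>x\<in>zspan S. of_int n *s f x \<in> Z)"
proof -
  obtain n :: int where n: "n > 0" "\<forall>s\<in>S. of_int n *s f s \<in> Z"
    using common_multiple[OF assms(1), where f = f, OF assms(5) assms(4)] by blast
  have f0: "f 0 = 0"
    using assms(3)[of 0 0] by simp
  have "zmodule {x. of_int n *s f x \<in> Z}"
    unfolding zmodule_def
  proof (intro conjI ballI; clarsimp)
    show "of_int n *s f 0 \<in> Z"
      using assms(4) f0 by (simp add: zmodule_def)
    fix x y assume xy: "of_int n *s f x \<in> Z" "of_int n *s f y \<in> Z"
    have "f (x - y) = f x - f y"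
      using assms(2)[of "x - y" y] by simp
    then show "of_int n *s f (x - y) \<in> Z"
      using assms(4) xy by (simp add: scale_right_diff_distrib zmodule_def)
  qed
  then have "zspan S \<subseteq> {x. of_int n *s f x \<in> Z}"
    using n by (intro zspan_minimal) auto
  then show ?thesis
    using n(1) by blast
qed

text \<open>Reduce the coefficients modulo \<open>n\<close>. The elements of \<open>S\<close> may be
  dependent, so different coefficients may give the same representative; what counts is that there
  are finitely many.\<close>

lemma zspan_residues:
  assumes "finite S" "(n::int) > 0"
  shows "\<exists>T\<subseteq>zspan S. finite T \<and> (\<forall>x\<in>zspan S. \<exists>t\<in>T. \<exists>y\<in>zspan S. x = t + of_int n *s y)"
proof -
  define T where "T = (\<lambda>c. \<Sum>s\<in>S. of_int (c s) *s s) ` (PiE S (\<lambda>_. {0..<n}))"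
  have "finite T"
    unfolding T_def using assms(1) by (intro finite_imageI finite_PiE) auto
  moreover have "T \<subseteq> zspan S"
    unfolding T_def zspan_def by blast
  moreover have "\<exists>t\<in>T. \<exists>y\<in>zspan S. x = t + of_int n *s y" if "x \<in> zspan S" for x
  proof -
    obtain c where c: "x = (\<Sum>s\<in>S. of_int (c s) *s s)"
      using \<open>x \<in> zspan S\<close> unfolding zspan_def by blast
    define t where "t = (\<Sum>s\<in>S. of_int (c s mod n) *s s)"
    define y where "y = (\<Sum>s\<in>S. of_int (c s div n) *s s)"
    have "t = (\<Sum>s\<in>S. of_int (restrict (\<lambda>s. c s mod n) S s) *s s)"
      unfolding t_def by (rule sum.cong) auto
    then have "t \<in> T"
      unfolding T_def using assms(2)
      by (intro image_eqI[where x = "restrict (\<lambda>s. c s mod n) S"]) auto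
    moreover have "y \<in> zspan S"
      unfolding y_def zspan_def by (rule range_eqI) simp
    moreover have "x = t + of_int n *s y"
    proof -
      have "of_int (c s) *s s = of_int (c s mod n) *s s + of_int n *s of_int (c s div n) *s s" for s
      proof -
        have "(of_int (c s) :: rat) = of_int (c s mod n) + of_int n * of_int (c s div n)"
          by (metis mod_mult_div_eq of_int_add of_int_mult)
        then show ?thesis
          by (simp add: scale_left_distrib)
      qed
      then show ?thesis
        unfolding c t_def y_def by (simp add: scale_sum_right sum.distrib)
    qed
    ultimately show ?thesis by blast
  qed
  ultimately show ?thesis by blast
qed

lemma rat_multiple_int: "\<exists>n::int. n > 0 \<and> (\<exists>m::int. of_int n * (q::rat) = of_int m)"
proof -
  obtain a b where "quotient_of q = (a, b)" by fastforce
  then have "b > 0" "q = of_int a / of_int b"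
    by (simp_all add: quotient_of_denom_pos quotient_of_div)
  then show ?thesis
    by (intro exI[of _ b]) auto
qed

lemma span_multiple_zspan:
  assumes "finite S" "x \<in> span S"
  shows "\<exists>n::int. n > 0 \<and> of_int n *s x \<in> zspan S"
proof -
  obtain c where c: "x = (\<Sum>s\<in>S. c s *s s)"
    using assms by (auto simp: span_finite)
  have "\<exists>n::int. n > 0 \<and> of_int n *s (c s *s s) \<in> zspan S" if "s \<in> S" for s
  proof -
    obtain n m :: int where "n > 0" "of_int n * c s = of_int m"
      using rat_multiple_int by blast
    then show ?thesis
      using zmodule_scale[OF zmodule_zspan zspan_base[OF assms(1) that], of m]
      by (intro exI[of _ n]) simp
  qed
  then obtain n :: int where "n > 0" "\<forall>s\<in>S. of_int n *s (c s *s s) \<in> zspan S"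
    using common_multiple[OF assms(1) _ zmodule_zspan, where f = "\<lambda>s. c s *s s"] by blast
  then show ?thesis
    unfolding c scale_sum_right by (intro exI[of _ n]) (auto intro: zmodule_sum zmodule_zspan)
qed

end

locale rat_algebra = rat_vector_space scale
  for scale :: "rat \<Rightarrow> 'a::ring_1 \<Rightarrow> 'a" (infixr "*s" 75) +
  assumes scale_mult_left: "(q *s x) * y = q *s (x * y)"
    and scale_mult_right: "x * (q *s y) = q *s (x * y)"
begin

lemma scale_power: "(q *s x) ^ n = (q ^ n) *s (x ^ n)"
  by (induction n) (simp_all add: scale_mult_left scale_mult_right mult.commute)

lemma nilp_scale: "nilp x \<Longrightarrow> nilp (q *s x)"
  unfolding nilp_def scale_power by (metis scale_zero_right)

end

text \<open>The ring type may be infinite-dimensional, as it is for endomorphisms of the sequence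
  space; \<open>A\<close> is a finite-dimensional subalgebra with the same unit, and
  \<open>F\<close> may lie outside it.\<close>

locale fd_algebra = rat_algebra +
  fixes A F :: "'a set"
  assumes subspace_A: "subspace A" and one_A: "1 \<in> A"
    and mult_A: "\<And>x y. x \<in> A \<Longrightarrow> y \<in> A \<Longrightarrow> x * y \<in> A"
    and finite_F: "finite F" and A_span: "A \<subseteq> span F"
begin

lemmas add_A = subspace_add[OF subspace_A]
lemmas diff_A = subspace_diff[OF subspace_A]
lemmas scale_A = subspace_scale[OF subspace_A]
lemmas zero_A = subspace_0[OF subspace_A]
lemmas closed_A = one_A mult_A add_A diff_A scale_A zero_A

lemma power_A: "x \<in> A \<Longrightarrow> x ^ n \<in> A"
  by (induction n) (auto simp: closed_A)

text \<open>Fitting's lemma in terms of idempotents. Some power \<open>x ^ m\<close> is a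
  combination of higher ones, so \<open>x ^ m = x ^ m * (x * y)\<close> with \<open>y\<close>
  commuting with \<open>x\<close>. Then a power of \<open>x * y\<close> is idempotent, and it is
  nonzero because \<open>x ^ m\<close> is.\<close>

lemma fitting:
  assumes x: "x \<in> A" and nn: "\<not> nilp x"
  obtains y where "y \<in> A" "x * y = y * x" "x * y \<noteq> 0" "(x * y) * (x * y) = x * y"
proof -
  define S where "S m = (\<lambda>j. x ^ j) ` {m..card F}" for m
  \<comment> \<open>the lowest power of \<open>x\<close> in a linear relation is a combination of higher ones\<close>
  have "\<exists>m\<le>card F. x ^ m \<in> span (S (Suc m))"
  proof (rule ccontr)
    assume "\<not> ?thesis"
    then have no: "x ^ m \<notin> span (S (Suc m))" if "m \<le> card F" for m
      using that by blast
    \<comment> \<open>If no power is spanned by the higher ones, the top \<open>k\<close> of the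
      powers with exponents 0 to \<open>card F\<close> are independent for every \<open>k\<close>;
      for \<open>k = card F + 1\<close> there are too many of them.\<close>
    have "independent (S (Suc (card F) - k)) \<and> card (S (Suc (card F) - k)) = k"
      if "k \<le> Suc (card F)" for k
      using that
    proof (induction k)
      case 0
      then show ?case by (simp add: S_def independent_empty)
    next
      case (Suc k)
      define m where "m = card F - k"
      have m: "m \<le> card F" "Suc (card F) - Suc k = m" "Suc (card F) - k = Suc m"
        using Suc.prems by (auto simp: m_def)
      have "S m = insert (x ^ m) (S (Suc m))"
        unfolding S_def using m(1) by (simp add: atLeastAtMost_insertL[symmetric])
      moreover have "x ^ m \<notin> S (Suc m)" "x ^ m \<notin> span (S (Suc m))"
        using no[OF m(1)] span_base by auto
      moreover have "finite (S (Suc m))"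
        by (simp add: S_def)
      ultimately show ?case
        using Suc m by (simp add: independent_insert)
    qed
    from this[of "Suc (card F)"] have "independent (S 0)" "card (S 0) = Suc (card F)"
      by auto
    moreover have "S 0 \<subseteq> span F"
      unfolding S_def using power_A[OF x] A_span by auto
    ultimately show False
      using independent_span_bound[OF finite_F] by fastforce
  qed
  then obtain m where m: "x ^ m \<in> span (S (Suc m))"
    by blast
  \<comment> \<open>The commutant of \<open>x\<close> in \<open>A\<close> stands in for the
    polynomials in \<open>x\<close>: its image under multiplication by \<open>x ^ (m + 1)\<close> is
    a subspace containing the higher powers in question, hence also \<open>x ^ m\<close>.\<close>
  define Y where "Y = {y \<in> A. x * y = y * x}"
  have "subspace ((\<lambda>y. x ^ m * (x * y)) ` Y)"
  proof -
    have Y: "subspace Y"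
      unfolding Y_def
      by (rule subspaceI) (auto simp: closed_A algebra_simps scale_mult_left scale_mult_right)
    show ?thesis
    proof (rule subspaceI)
      show "0 \<in> (\<lambda>y. x ^ m * (x * y)) ` Y"
        using subspace_0[OF Y] by force
      show "a + b \<in> (\<lambda>y. x ^ m * (x * y)) ` Y"
        if "a \<in> (\<lambda>y. x ^ m * (x * y)) ` Y" "b \<in> (\<lambda>y. x ^ m * (x * y)) ` Y" for a b
        using that subspace_add[OF Y] by (auto simp flip: distrib_left)
      show "c *s a \<in> (\<lambda>y. x ^ m * (x * y)) ` Y"
        if "a \<in> (\<lambda>y. x ^ m * (x * y)) ` Y" for a c
        using that subspace_scale[OF Y] by (auto simp flip: scale_mult_right)
    qed
  qed
  moreover have "S (Suc m) \<subseteq> (\<lambda>y. x ^ m * (x * y)) ` Y"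
  proof
    fix z assume "z \<in> S (Suc m)"
    then obtain j where j: "z = x ^ j" "Suc m \<le> j"
      unfolding S_def by auto
    then have "j = m + Suc (j - Suc m)"
      by simp
    then have "z = x ^ m * (x * x ^ (j - Suc m))"
      unfolding j(1) by (metis power_Suc power_add)
    then show "z \<in> (\<lambda>y. x ^ m * (x * y)) ` Y"
      unfolding Y_def using power_A[OF x]
      by (intro image_eqI[where x = "x ^ (j - Suc m)"]) (simp_all add: power_commutes)
  qed
  ultimately obtain y where y: "y \<in> A" "x * y = y * x" "x ^ m = x ^ m * (x * y)"
    using m span_minimal unfolding Y_def by blast
  have absorb: "x ^ m * (x * y) ^ k = x ^ m" for k
  proof (induction k)
    case (Suc k)
    have "x ^ m * (x * y) ^ Suc k = x ^ m * (x * y) * (x * y) ^ k"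
      by (simp add: mult.assoc)
    then show ?case
      using Suc y(3) by simp
  qed simp
  \<comment> \<open>The exponent \<open>m + 1\<close> lets \<open>p\<close> be written as
    \<open>y ^ (m + 1) * x ^ (m + 1)\<close>, and the factor \<open>x ^ m\<close> absorbs a second
    copy of \<open>p\<close>.\<close>
  define p where "p = (x * y) ^ Suc m"
  define w where "w = y * (x * y) ^ m"
  have p: "p = x * w"
    by (simp add: p_def w_def mult.assoc)
  have comm: "x * (x * y) ^ k = (x * y) ^ k * x" for k
  proof -
    have "x * y * x = x * (x * y)"
      using y(2) by (metis mult.assoc)
    then show ?thesis
      using power_commuting_commutes[of "x * y" x k] by simp
  qed
  have xyk: "(x * y) ^ k = y ^ k * x ^ k" for k
  proof (induction k)
    case (Suc k)
    have "(x * y) ^ Suc k = y * (x * y ^ k) * x ^ k"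
      using Suc y(2) by (simp add: mult.assoc)
    also have "x * y ^ k = y ^ k * x"
      using power_commuting_commutes[of y x k] y(2) by simp
    finally show ?case by (simp add: mult.assoc)
  qed simp
  have idem: "p * p = p"
  proof -
    have "p * p = y ^ Suc m * (x * (x ^ m * p))"
    proof -
      have "p = y ^ Suc m * x ^ Suc m"
        unfolding p_def by (rule xyk)
      then have "p * p = y ^ Suc m * x ^ Suc m * p"
        by (rule arg_cong)
      then show ?thesis
        by (simp only: power_Suc mult.assoc)
    qed
    also have "x ^ m * p = x ^ m"
      unfolding p_def by (rule absorb)
    also have "y ^ Suc m * (x * x ^ m) = p"
      unfolding p_def xyk by simp
    finally show ?thesis .
  qed
  have "p \<noteq> 0"
  proof
    assume "p = 0"
    then have "x ^ m = 0"
      using absorb[of "Suc m"] unfolding p_def by (metis mult_zero_right)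
    then show False
      using nn unfolding nilp_def by blast
  qed
  moreover have "w \<in> A"
    unfolding w_def by (simp add: closed_A power_A x y)
  moreover have "x * w = w * x"
  proof -
    have "x * w = (x * y) * (x * y) ^ m"
      by (simp add: w_def mult.assoc)
    also have "\<dots> = y * (x * (x * y) ^ m)"
      using y(2) by (simp add: mult.assoc)
    also have "\<dots> = w * x"
      unfolding w_def comm by (simp add: mult.assoc)
    finally show ?thesis .
  qed
  ultimately show ?thesis
    using that idem unfolding p by blast
qed

end

section \<open>The radical and primitive idempotents\<close>

context fd_algebra
begin

text \<open>In a finite-dimensional algebra this is the Jacobson radical, described by nil right
  ideals. In this form absorption is immediate and the work lies in closure under addition.\<close>

definition J :: "'a set"
  where "J = {a \<in> A. \<forall>x\<in>A. nilp (a * x)}"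

lemma J_A: "a \<in> J \<Longrightarrow> a \<in> A"
  by (simp add: J_def)

lemma J_nilp: "a \<in> J \<Longrightarrow> nilp a"
  unfolding J_def using one_A by force

lemma J_mult_right: "a \<in> J \<Longrightarrow> x \<in> A \<Longrightarrow> a * x \<in> J"
  unfolding J_def by (auto simp: closed_A mult.assoc)

lemma J_mult_left: "a \<in> J \<Longrightarrow> x \<in> A \<Longrightarrow> x * a \<in> J"
  unfolding J_def
proof clarify
  fix y assume a: "a \<in> A" "\<forall>x\<in>A. nilp (a * x)" and xy: "x \<in> A" "y \<in> A"
  then have "nilp (a * (y * x))"
    by (simp add: closed_A)
  then show "x * a \<in> A \<and> (\<forall>y\<in>A. nilp (x * a * y))"
    using a xy nilp_swap[of "a * _" x] by (auto simp: closed_A mult.assoc)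
qed

lemma J_scale: "a \<in> J \<Longrightarrow> q *s a \<in> J"
  unfolding J_def by (auto simp: closed_A scale_mult_left nilp_scale)

text \<open>If \<open>(a + b) * x\<close> is not nilpotent, a multiple of it is a nonzero idempotent
  \<open>p\<close>. In the corner of \<open>p\<close> the unit is then a sum of two nilpotent
  elements \<open>s\<close> and \<open>t\<close>, which is impossible, as \<open>t = p - s\<close>
  is invertible there.\<close>

lemma J_add:
  assumes a: "a \<in> J" and b: "b \<in> J"
  shows "a + b \<in> J"
proof -
  have "nilp ((a + b) * x)" if x: "x \<in> A" for x
  proof (rule ccontr)
    assume "\<not> nilp ((a + b) * x)"
    moreover have "(a + b) * x \<in> A"
      using a b x by (simp add: J_A closed_A)
    ultimately obtain y where y: "y \<in> A" "(a + b) * x * y \<noteq> 0"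
      "((a + b) * x * y) * ((a + b) * x * y) = (a + b) * x * y"
      using fitting by metis
    define p where "p = (a + b) * x * y"
    have p: "p \<in> A" "p * p = p" "p \<noteq> 0"
      using y a b x by (simp_all add: p_def J_A closed_A)
    define s where "s = p * (a * x * y) * p"
    define t where "t = p * (b * x * y) * p"
    have "s \<in> J" "t \<in> J"
      unfolding s_def t_def using a b p x y by (simp_all add: J_mult_left J_mult_right)
    then obtain m n where mn: "s ^ m = 0" "t ^ n = 0"
      using J_nilp unfolding nilp_def by blast
    have "s + t = p * p * p"
      by (simp add: s_def t_def p_def algebra_simps)
    then have t: "t = p - s"
      using p(2) by (simp add: algebra_simps)
    have ps: "p * s = s" "s * p = s"
      using p(2) by (simp_all add: s_def mult.assoc) (metis p(2) mult.assoc)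
    obtain w where w: "(p - s) * w = p"
      using geometric_inverse_corner(1)[OF ps p(2) mn(1)] by blast
    have pt: "p * t = t"
      using ps p(2) by (simp add: t algebra_simps)
    \<comment> \<open>Every power of \<open>t\<close> keeps a right inverse relative to
      \<open>p\<close>, so \<open>t\<close> can be nilpotent only if \<open>p = 0\<close>.\<close>
    have "\<exists>u. t ^ k * u = p" for k
    proof (induction k)
      case 0
      then show ?case by auto
    next
      case (Suc k)
      then obtain u where u: "t ^ k * u = p" by blast
      have "t ^ Suc k * (u * w) = t * (t ^ k * u) * w"
        by (simp add: mult.assoc)
      also have "\<dots> = t * p * w"
        by (simp add: u)
      also have "t * p = t"
        using ps p(2) by (simp add: t algebra_simps)
      finally show ?case
        using w t by metis
    qed
    then show False
      using mn(2) p(3) by (metis mult_zero_left)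
  qed
  then show ?thesis
    using a b by (auto simp: J_def closed_A)
qed

lemma J_zero: "0 \<in> J"
  unfolding J_def nilp_def by (auto simp: closed_A intro: exI[of _ 1])

lemma J_diff: "a \<in> J \<Longrightarrow> b \<in> J \<Longrightarrow> a - b \<in> J"
  using J_add[of a "(-1) *s b"] J_scale[of b "-1"] by simp

lemma J_neg: "a \<in> J \<Longrightarrow> - a \<in> J"
  using J_scale[of a "-1"] by simp

lemma subspace_J: "subspace J"
  by (rule subspaceI) (auto simp: J_zero J_add J_scale)

lemma J_sum: "(\<And>i. i \<in> I \<Longrightarrow> f i \<in> J) \<Longrightarrow> sum f I \<in> J"
  by (rule subspace_sum[OF subspace_J])

section \<open>Primitive idempotents and their local corners\<close>

definition prim :: "'a \<Rightarrow> bool"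
  where "prim e \<longleftrightarrow> e \<in> A \<and> e \<noteq> 0 \<and> e * e = e \<and>
    (\<forall>p\<in>A. p * p = p \<and> e * p = p \<and> p * e = p \<longrightarrow> p = 0 \<or> p = e)"

text \<open>The idempotent \<open>x * y\<close> from \<open>fitting\<close> lies in the corner and
  is nonzero, hence equals \<open>e\<close>; compressing \<open>y\<close> to
  \<open>e * y * e\<close> gives the inverse. So the corner of a primitive idempotent is local, its
  nonunits being nilpotent.\<close>

lemma prim_unit:
  assumes e: "prim e" and x: "x \<in> A" "e * x = x" "x * e = x" and nn: "\<not> nilp x"
  obtains y where "y \<in> A" "e * y = y" "y * e = y" "x * y = e" "y * x = e"
proof -
  obtain y where y: "y \<in> A" "x * y = y * x" "x * y \<noteq> 0" "(x * y) * (x * y) = x * y"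
    using fitting[OF x(1) nn] by blast
  have "e * (x * y) = x * y" "(x * y) * e = x * y"
    using x by (simp_all flip: mult.assoc) (simp add: y(2) x mult.assoc)
  then have xy: "x * y = e"
    using e y x(1) unfolding prim_def by (metis mult_A)
  have ee: "e * e = e" "e \<in> A"
    using e by (simp_all add: prim_def)
  have "x * (e * y * e) = e" "(e * y * e) * x = e"
  proof -
    have "x * (e * y * e) = (x * e) * y * e"
      by (simp add: mult.assoc)
    then show "x * (e * y * e) = e"
      using x xy ee by simp
    have "(e * y * e) * x = e * (y * (e * x))"
      by (simp add: mult.assoc)
    then show "(e * y * e) * x = e"
      using x xy y ee by simp
  qed
  moreover have "e * (e * y * e) = e * y * e" "(e * y * e) * e = e * y * e"
    using ee by (simp_all add: mult.assoc) (simp flip: mult.assoc)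
  ultimately show ?thesis
    using that[of "e * y * e"] ee y by (simp add: closed_A)
qed

text \<open>Induction on the dimension of the right ideal \<open>e A\<close>. An idempotent
  \<open>p\<close> of the corner other than 0 and \<open>e\<close> splits \<open>e\<close> as
  \<open>p + (e - p)\<close>, and both parts generate smaller right ideals.\<close>

lemma prim_decomposition:
  assumes "e \<in> A" "e * e = e"
  shows "\<exists>es. (\<forall>p\<in>set es. prim p) \<and> sum_list es = e"
  using assms
proof (induction "dim {x \<in> A. e * x = x}" arbitrary: e rule: less_induct)
  case less
  show ?case
  proof (cases "e = 0 \<or> prim e")
    case True
    then show ?thesis
      by (metis empty_iff list.set(1) set_ConsD sum_list.Cons sum_list.Nil add.right_neutral)
  next
    case False
    then obtain p where p: "p \<in> A" "p * p = p" "e * p = p" "p * e = p" "p \<noteq> 0" "p \<noteq> e"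
      using less.prems unfolding prim_def by blast
    have sub: "subspace {x \<in> A. q * x = x}" for q
      by (rule subspaceI) (auto simp: closed_A distrib_left scale_mult_right)
    have decrease: "dim {x \<in> A. q * x = x} < dim {x \<in> A. e * x = x}"
      if q: "q \<in> A" "q * q = q" "e * q = q" "q * e = q" "q \<noteq> e" for q
    proof (rule dim_strict_mono[OF finite_F _ sub])
      show "{x \<in> A. e * x = x} \<subseteq> span F"
        using A_span by blast
      have "q * x = x \<Longrightarrow> e * x = x" for x
        using q(3) by (metis mult.assoc)
      \<comment> \<open>\<open>e\<close> itself lies in \<open>e A\<close> but not in
        \<open>q A\<close>, so the inclusion is strict.\<close>
      moreover have "q * e \<noteq> e"
        using q by simp
      ultimately show "{x \<in> A. q * x = x} \<subset> {x \<in> A. e * x = x}"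
        using less.prems by blast
    qed
    have ep: "e - p \<in> A" "(e - p) * (e - p) = e - p" "e * (e - p) = e - p" "(e - p) * e = e - p"
      "e - p \<noteq> e"
      using p less.prems by (simp_all add: algebra_simps closed_A)
    obtain es where es: "\<forall>p\<in>set es. prim p" "sum_list es = p"
      using less.hyps[OF decrease] p by blast
    moreover obtain es' where "\<forall>p\<in>set es'. prim p" "sum_list es' = e - p"
      using less.hyps[OF decrease] ep by blast
    ultimately show ?thesis
      by (intro exI[of _ "es @ es'"]) auto
  qed
qed

end

section \<open>Norm forms on corners\<close>

lemma det_in_Ints:
  fixes M :: "rat mat"
  assumes M: "M \<in> carrier_mat n n" and ints: "\<And>i j. i < n \<Longrightarrow> j < n \<Longrightarrow> M $$ (i, j) \<in> \<int>"
  shows "det M \<in> \<int>"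
  unfolding det_def'[OF M]
proof (intro Ints_sum Ints_mult Ints_prod)
  fix p assume p: "p \<in> {p. p permutes {0..<n}}"
  fix i assume i: "i \<in> {0..<n}"
  then have "p i < n"
    using p permutes_in_image by fastforce
  then show "M $$ (i, p i) \<in> \<int>"
    using ints i by simp
qed simp

text \<open>The Leibniz formula has \<open>fact n\<close> terms, and each is at most the entry
  bound, which is at most 1, since \<open>n > 0\<close> leaves at least one factor;
  \<open>fact n / (fact n + 1)\<close> is below 1.\<close>

lemma det_small:
  fixes M :: "rat mat"
  assumes M: "M \<in> carrier_mat n n" and n: "n > 0"
    and small: "\<And>i j. i < n \<Longrightarrow> j < n \<Longrightarrow> \<bar>M $$ (i, j)\<bar> \<le> 1 / (fact n + 1)"
  shows "\<bar>det M\<bar> < 1"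
proof -
  define c :: rat where "c = 1 / (fact n + 1)"
  have fact_pos: "(0::rat) < fact n + 1"
    by (simp add: add_pos_pos)
  have c: "0 \<le> c" "c \<le> 1"
    using fact_pos by (simp_all add: c_def)
  have "\<bar>det M\<bar> \<le> (\<Sum>p\<in>{p. p permutes {0..<n}}. \<bar>signof p * (\<Prod>i = 0..<n. M $$ (i, p i))\<bar>)"
    unfolding det_def'[OF M] by (rule sum_abs)
  also have "\<dots> \<le> (\<Sum>p\<in>{p. p permutes {0..<n}}. c)"
  proof (rule sum_mono)
    fix p assume p: "p \<in> {p. p permutes {0..<n}}"
    have "\<bar>signof p * (\<Prod>i = 0..<n. M $$ (i, p i))\<bar> = (\<Prod>i = 0..<n. \<bar>M $$ (i, p i)\<bar>)"
      by (simp add: abs_mult abs_prod sign_def)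
    also have "\<dots> \<le> (\<Prod>i = 0..<n. c)"
    proof (rule prod_mono)
      fix i assume i: "i \<in> {0..<n}"
      then have "p i < n"
        using p permutes_in_image by fastforce
      then show "0 \<le> \<bar>M $$ (i, p i)\<bar> \<and> \<bar>M $$ (i, p i)\<bar> \<le> c"
        using small i by (simp add: c_def)
    qed
    also have "\<dots> \<le> c"
      using power_decreasing[of 1 n c] n c by simp
    finally show "\<bar>signof p * (\<Prod>i = 0..<n. M $$ (i, p i))\<bar> \<le> c" .
  qed
  also have "\<dots> = fact n * c"
    by (simp add: card_permutations)
  also have "\<dots> < 1"
    unfolding c_def using fact_pos by (simp add: field_simps)
  finally show ?thesis .
qed

text \<open>Dirichlet's pigeonhole argument: modulo 1, \<open>Q ^ card B + 1\<close> multiples of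
  the vector \<open>z\<close> fall into \<open>Q ^ card B\<close> cubes of side
  \<open>1 / Q\<close>, and two in the same cube have the required difference. The bound on
  \<open>t\<close> does not involve \<open>z\<close>.\<close>

lemma simultaneous_approximation:
  fixes z :: "'b \<Rightarrow> rat"
  assumes B: "finite B" and Q: "Q > 0"
  shows "\<exists>t\<in>{1..Q ^ card B}. \<exists>c::'b \<Rightarrow> int. \<forall>b\<in>B. \<bar>of_nat t * z b - of_int (c b)\<bar> \<le> 1 / of_nat Q"
proof -
  define h where "h t = restrict (\<lambda>b. nat \<lfloor>of_nat Q * frac (of_nat t * z b)\<rfloor>) B" for t :: nat
  have bound: "nat \<lfloor>of_nat Q * frac (y::rat)\<rfloor> < Q" for y
  proof -
    have "of_nat Q * frac y < of_nat Q"
      using Q frac_lt_1[of y] by simp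
    then show ?thesis
      using Q by (simp add: nat_less_iff frac_ge_0 floor_less_iff)
  qed
  have "h ` {0..Q ^ card B} \<subseteq> PiE B (\<lambda>_. {..<Q})"
    using bound by (auto simp: h_def)
  then have "card (h ` {0..Q ^ card B}) \<le> card (PiE B (\<lambda>_. {..<Q}))"
    using B by (intro card_mono finite_PiE) auto
  also have "\<dots> = Q ^ card B"
    using B by (simp add: card_PiE)
  finally have "\<not> inj_on h {0..Q ^ card B}"
    using card_image by fastforce
  then obtain s t where st: "s < t" "t \<le> Q ^ card B" "h s = h t"
    unfolding inj_on_def by (metis atLeastAtMost_iff linorder_neqE_nat)
  have "\<bar>of_nat (t - s) * z b - of_int (\<lfloor>of_nat t * z b\<rfloor> - \<lfloor>of_nat s * z b\<rfloor>)\<bar> \<le> 1 / of_nat Q"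
    if b: "b \<in> B" for b
  proof -
    define u v where "u = frac (of_nat s * z b)" and "v = frac (of_nat t * z b)"
    have "nat \<lfloor>of_nat Q * u\<rfloor> = nat \<lfloor>of_nat Q * v\<rfloor>"
      using fun_cong[OF st(3), of b] b by (simp add: h_def u_def v_def)
    moreover have "0 \<le> \<lfloor>of_nat Q * u\<rfloor>" "0 \<le> \<lfloor>of_nat Q * v\<rfloor>"
      by (simp_all add: u_def v_def frac_ge_0)
    ultimately have "\<lfloor>of_nat Q * u\<rfloor> = \<lfloor>of_nat Q * v\<rfloor>"
      by (simp only: nat_eq_iff2)
    then have "\<bar>of_nat Q * v - of_nat Q * u\<bar> \<le> 1"
      by linarith
    then have "of_nat Q * \<bar>v - u\<bar> \<le> 1"
      by (simp flip: right_diff_distrib add: abs_mult)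
    then have "\<bar>v - u\<bar> \<le> 1 / of_nat Q"
      using Q by (simp add: field_simps)
    moreover have "of_nat (t - s) * z b - of_int (\<lfloor>of_nat t * z b\<rfloor> - \<lfloor>of_nat s * z b\<rfloor>) = v - u"
      using st(1) by (simp add: u_def v_def frac_def of_nat_diff left_diff_distrib)
    ultimately show ?thesis by simp
  qed
  then show ?thesis
    using st by (intro bexI[of _ "t - s"] exI[of _ "\<lambda>b. \<lfloor>of_nat t * z b\<rfloor> - \<lfloor>of_nat s * z b\<rfloor>"]) auto
qed

text \<open>Meant for the corner \<open>e A e\<close> with a rational basis \<open>B\<close>. The
  unit is \<open>e\<close>, not \<open>1\<close>, and the lattice \<open>zspan B\<close> need not be
  closed under multiplication.\<close>

locale lattice_algebra = rat_algebra +
  fixes D B :: "'a set" and e :: 'a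
  assumes subspace_D: "subspace D" and mult_D: "\<And>x y. x \<in> D \<Longrightarrow> y \<in> D \<Longrightarrow> x * y \<in> D"
    and e_D: "e \<in> D" and e_left: "\<And>x. x \<in> D \<Longrightarrow> e * x = x" and e_nonzero: "e \<noteq> 0"
    and finite_B: "finite B" and independent_B: "independent B"
    and B_subset: "B \<subseteq> D" and D_subset: "D \<subseteq> span B"
begin

lemma zspan_coords: "x \<in> zspan B \<Longrightarrow> representation B x b \<in> \<int>"
proof -
  assume "x \<in> zspan B"
  then obtain c where c: "x = (\<Sum>b\<in>B. of_int (c b) *s b)"
    unfolding zspan_def by blast
  have "representation B x b = (\<Sum>b'\<in>B. of_int (c b') * (if b = b' then 1 else 0))"
    unfolding c using independent_B
    by (subst representation_sum)
      (auto simp: representation_scale representation_basis span_base span_scale intro!: sum.cong)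
  then show ?thesis
    by (auto intro!: Ints_sum)
qed

text \<open>\<open>N x\<close> is the determinant of left multiplication by \<open>x\<close> on
  \<open>D\<close> in the basis \<open>B\<close>. The denominator \<open>s\<close> and the threshold
  \<open>\<delta>\<close> depend only on the structure constants of \<open>B\<close>, which keeps
  later bounds uniform.\<close>

lemma norm_form:
  obtains N :: "'a \<Rightarrow> rat" and s :: int and \<delta> :: rat
  where "\<And>x y. x \<in> D \<Longrightarrow> y \<in> D \<Longrightarrow> N (x * y) = N x * N y" and "N e = 1"
    and "\<And>q x. x \<in> D \<Longrightarrow> N (q *s x) = q ^ card B * N x"
    and "s > 0" and "\<And>x. x \<in> zspan B \<Longrightarrow> of_int s * N x \<in> \<int>"
    and "\<delta> > 0" and "\<And>x. x \<in> D \<Longrightarrow> (\<forall>b\<in>B. \<bar>representation B x b\<bar> \<le> \<delta>) \<Longrightarrow> \<bar>N x\<bar> < 1"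
proof -
  obtain bs where bs: "set bs = B" "distinct bs"
    using finite_B finite_distinct_list by blast
  define d where "d = length bs"
  have d: "d = card B"
    using bs distinct_card d_def by metis
  have bB: "bs ! i \<in> B" if "i < d" for i
    using that bs d_def nth_mem by blast
  have bD: "bs ! i \<in> D" if "i < d" for i
    using bB[OF that] B_subset by blast
  have sumB: "(\<Sum>b\<in>B. f b) = (\<Sum>i = 0..<d. f (bs ! i))" for f :: "'a \<Rightarrow> 'c::comm_monoid_add"
    using sum_list_distinct_conv_sum_set[OF bs(2), of f] bs(1)
    by (simp add: sum_list_sum_nth d_def)
  have span: "x \<in> D \<Longrightarrow> x \<in> span B" for x
    using D_subset by blast
  define co where "co x i = representation B x (bs ! i)" for x i
  have expand: "(\<Sum>k = 0..<d. co x k *s bs ! k) = x" if "x \<in> D" for x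
    using sum_representation_eq[OF independent_B span[OF that] finite_B subset_refl]
    by (simp add: sumB co_def)
  have co_scale: "co (q *s x) i = q * co x i" if "x \<in> D" for q x i
    unfolding co_def using representation_scale[OF independent_B span[OF that]] by simp
  have co_sum: "co (sum f I) i = (\<Sum>k\<in>I. co (f k) i)" if "\<And>k. k \<in> I \<Longrightarrow> f k \<in> D"
    for f :: "nat \<Rightarrow> 'a" and I i
    unfolding co_def using representation_sum[OF independent_B, of I f] span[OF that] by auto
  \<comment> \<open>the matrix of left multiplication by \<open>x\<close>\<close>
  define L where "L x = mat d d (\<lambda>(i, j). co (x * bs ! j) i)" for x
  have L_carrier: "L x \<in> carrier_mat d d" for x
    by (simp add: L_def)
  have scale_D: "x \<in> D \<Longrightarrow> q *s x \<in> D" for q x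
    using subspace_D by (rule subspace_scale)
  have L_mult: "L (x * y) = L x * L y" if xy: "x \<in> D" "y \<in> D" for x y
  proof (rule eq_matI)
    fix i j assume "i < dim_row (L x * L y)" "j < dim_col (L x * L y)"
    then have ij: "i < d" "j < d"
      by (simp_all add: L_def)
    have yj: "y * bs ! j \<in> D"
      using xy bD ij by (simp add: mult_D)
    have "x * y * bs ! j = x * (\<Sum>k = 0..<d. co (y * bs ! j) k *s bs ! k)"
      using expand[OF yj] by (simp add: mult.assoc)
    also have "\<dots> = (\<Sum>k = 0..<d. co (y * bs ! j) k *s (x * bs ! k))"
      by (simp add: sum_distrib_left scale_mult_right)
    finally have xyj: "x * y * bs ! j = (\<Sum>k = 0..<d. co (y * bs ! j) k *s (x * bs ! k))" .
    have "co (x * y * bs ! j) i = (\<Sum>k = 0..<d. co (y * bs ! j) k * co (x * bs ! k) i)"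
      using xy bD by (subst xyj, subst co_sum)
        (auto intro!: sum.cong simp: co_scale scale_D mult_D)
    then show "L (x * y) $$ (i, j) = (L x * L y) $$ (i, j)"
      using ij by (simp add: L_def scalar_prod_def mult.commute)
  qed (simp_all add: L_def)
  have L_scale: "L (q *s x) = q \<cdot>\<^sub>m L x" if "x \<in> D" for q x
    using that bD by (intro eq_matI) (simp_all add: L_def scale_mult_left co_scale mult_D)
  have L_one: "L e = 1\<^sub>m d"
  proof (rule eq_matI)
    fix i j assume "i < dim_row (1\<^sub>m d)" "j < dim_col (1\<^sub>m d)"
    then show "L e $$ (i, j) = 1\<^sub>m d $$ (i, j)"
      using bD[of j] bB[of j] bs
      by (simp add: L_def co_def e_left representation_basis[OF independent_B] nth_eq_iff_index_eq
          d_def)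
  qed (simp_all add: L_def)
  have d_pos: "d > 0"
  proof (rule ccontr)
    assume "\<not> d > 0"
    then have "D \<subseteq> {0}"
      using D_subset finite_B d by auto
    then show False
      using e_D e_nonzero by blast
  qed
  have L_entry: "L x $$ (i, j) = (\<Sum>k = 0..<d. co x k * co (bs ! k * bs ! j) i)"
    if "x \<in> D" "i < d" "j < d" for x i j
  proof -
    have "x * bs ! j = (\<Sum>k = 0..<d. co x k *s bs ! k) * bs ! j"
      using expand[OF that(1)] by simp
    also have "\<dots> = (\<Sum>k = 0..<d. co x k *s (bs ! k * bs ! j))"
      by (simp add: sum_distrib_right scale_mult_left)
    finally show ?thesis
      using that bD by (simp add: L_def, subst co_sum)
        (auto intro!: sum.cong simp: co_scale scale_D mult_D)
  qed
  \<comment> \<open>\<open>s\<close> clears the denominators of the structure constants; the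
    determinant of a matrix of size \<open>d\<close> then needs the factor
    \<open>s ^ d\<close>.\<close>
  have "\<exists>s::int. s > 0 \<and> (\<forall>p\<in>{0..<d} \<times> {0..<d}. of_int s *s (bs ! fst p * bs ! snd p) \<in> zspan B)"
  proof (rule common_multiple[OF _ _ zmodule_zspan])
    fix p assume "p \<in> {0..<d} \<times> {0..<d}"
    then have "bs ! fst p * bs ! snd p \<in> span B"
      using bD by (intro span mult_D) auto
    then show "\<exists>n::int. n > 0 \<and> of_int n *s (bs ! fst p * bs ! snd p) \<in> zspan B"
      by (rule span_multiple_zspan[OF finite_B])
  qed simp
  then obtain s :: int where s: "s > 0"
    and s': "\<And>k j. k < d \<Longrightarrow> j < d \<Longrightarrow> of_int s *s (bs ! k * bs ! j) \<in> zspan B"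
    by fastforce
  have integral: "of_int (s ^ d) * det (L x) \<in> \<int>" if x: "x \<in> zspan B" for x
  proof -
    have xD: "x \<in> D"
      using x zspan_subset_span span_minimal[OF B_subset subspace_D] by blast
    have "(of_int s \<cdot>\<^sub>m L x) $$ (i, j) \<in> \<int>" if ij: "i < d" "j < d" for i j
    proof -
      have "of_int s * co (bs ! k * bs ! j) i \<in> \<int>" if "k < d" for k
        using zspan_coords[OF s'[OF that ij(2)], of "bs ! i"] co_scale[of "bs ! k * bs ! j" "of_int s" i]
          bD ij that by (simp add: co_def mult_D)
      then have "co x k * (of_int s * co (bs ! k * bs ! j) i) \<in> \<int>" if "k < d" for k
        using Ints_mult[OF zspan_coords[OF x]] that unfolding co_def by blast
      moreover have "(of_int s \<cdot>\<^sub>m L x) $$ (i, j)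
          = (\<Sum>k = 0..<d. co x k * (of_int s * co (bs ! k * bs ! j) i))"
        using ij L_entry[OF xD ij] L_carrier[of x] by (simp add: sum_distrib_left mult.left_commute)
      ultimately show ?thesis
        by (auto intro!: Ints_sum)
    qed
    then have "det (of_int s \<cdot>\<^sub>m L x) \<in> \<int>"
      by (intro det_in_Ints[of _ d]) (simp_all add: L_carrier)
    then show ?thesis
      using L_carrier[of x] by simp
  qed
  \<comment> \<open>\<open>C\<close> bounds all structure constants. An entry of \<open>L x\<close>
    is a sum of \<open>d\<close> products of a coordinate and a structure constant, so coordinates
    up to \<open>\<delta>\<close> give entries up to \<open>\<eta>\<close>, the threshold of
    \<open>det_small\<close>; \<open>C + 1\<close> avoids a division by zero.\<close>
  define C where "C = (\<Sum>k = 0..<d. \<Sum>j = 0..<d. \<Sum>i = 0..<d. \<bar>co (bs ! k * bs ! j) i\<bar>)"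
  have C: "\<bar>co (bs ! k * bs ! j) i\<bar> \<le> C" if "k < d" "j < d" "i < d" for i j k
  proof -
    have "\<bar>co (bs ! k * bs ! j) i\<bar> \<le> (\<Sum>i = 0..<d. \<bar>co (bs ! k * bs ! j) i\<bar>)"
      using that by (intro member_le_sum) auto
    also have "\<dots> \<le> (\<Sum>j = 0..<d. \<Sum>i = 0..<d. \<bar>co (bs ! k * bs ! j) i\<bar>)"
      using that by (intro member_le_sum[where f = "\<lambda>j. \<Sum>i = 0..<d. \<bar>co (bs ! k * bs ! j) i\<bar>"])
        (auto intro!: sum_nonneg)
    also have "\<dots> \<le> C"
      unfolding C_def using that
      by (intro member_le_sum[where f = "\<lambda>k. \<Sum>j = 0..<d. \<Sum>i = 0..<d. \<bar>co (bs ! k * bs ! j) i\<bar>"])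
        (auto intro!: sum_nonneg)
    finally show ?thesis .
  qed
  have C_nonneg: "0 \<le> C"
    unfolding C_def by (intro sum_nonneg) auto
  define \<eta> :: rat where "\<eta> = 1 / (fact d + 1)"
  define \<delta> where "\<delta> = \<eta> / (of_nat d * (C + 1))"
  have \<eta>: "\<eta> > 0"
    by (simp add: \<eta>_def add_pos_pos)
  have \<delta>: "\<delta> > 0"
    using \<eta> C_nonneg d_pos by (simp add: \<delta>_def)
  have small: "\<bar>det (L x)\<bar> < 1" if x: "x \<in> D" "\<forall>b\<in>B. \<bar>representation B x b\<bar> \<le> \<delta>" for x
  proof (rule det_small[OF L_carrier d_pos])
    fix i j assume ij: "i < d" "j < d"
    have "\<bar>L x $$ (i, j)\<bar> \<le> (\<Sum>k = 0..<d. \<bar>co x k * co (bs ! k * bs ! j) i\<bar>)"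
      unfolding L_entry[OF x(1) ij] by (rule sum_abs)
    also have "\<dots> \<le> (\<Sum>k = 0..<d. \<delta> * (C + 1))"
      unfolding abs_mult
    proof (intro sum_mono mult_mono)
      fix k assume k: "k \<in> {0..<d}"
      then show "\<bar>co x k\<bar> \<le> \<delta>"
        using x(2) bB by (simp add: co_def)
      show "\<bar>co (bs ! k * bs ! j) i\<bar> \<le> C + 1"
        using C[of k j i] k ij by simp
    qed (use \<delta> in auto)
    also have "\<dots> = \<delta> * (of_nat d * (C + 1))"
      by simp
    also have "\<dots> = \<eta>"
    proof -
      have "of_nat d * (C + 1) \<noteq> 0"
        using d_pos C_nonneg by simp
      then show ?thesis
        unfolding \<delta>_def by (metis nonzero_divide_eq_eq)
    qed
    finally show "\<bar>L x $$ (i, j)\<bar> \<le> 1 / (fact d + 1)"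
      by (simp add: \<eta>_def)
  qed
  show ?thesis
  proof (rule that[of "\<lambda>x. det (L x)" "s ^ d" \<delta>])
    show "det (L (x * y)) = det (L x) * det (L y)" if "x \<in> D" "y \<in> D" for x y
      using L_mult[OF that] det_mult[OF L_carrier L_carrier] by simp
    show "det (L (q *s x)) = q ^ card B * det (L x)" if "x \<in> D" for q x
      using L_scale[OF that] L_carrier[of x] d by simp
  qed (use L_one s integral \<delta> small in auto)
qed

text \<open>Lattices in a local algebra are principal up to a factor \<open>k\<close> that is fixed
  before \<open>I\<close>. Choose a nonnilpotent \<open>x\<close> in \<open>I\<close> of least norm,
  with inverse \<open>x'\<close>. For \<open>y\<close> in \<open>I\<close>, some multiple
  \<open>t\<close> of \<open>x' * y\<close> is close to a lattice element \<open>q\<close>, so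
  \<open>t\<close> times \<open>y\<close> minus \<open>x * q\<close> has smaller norm than
  \<open>x\<close> and must be nilpotent.\<close>

lemma lattice_principal:
  assumes inverse: "\<forall>x\<in>D. \<not> nilp x \<longrightarrow> (\<exists>y\<in>D. x * y = e \<and> y * x = e)"
  shows "\<exists>k::int. k > 0 \<and> (\<forall>I. zmodule I \<and> I \<subseteq> D \<and> (\<forall>x\<in>I. \<forall>b\<in>B. x * b \<in> I) \<and>
      (\<exists>n::int. n > 0 \<and> (\<forall>x\<in>I. of_int n *s x \<in> zspan B)) \<and> (\<exists>x\<in>I. \<not> nilp x) \<longrightarrow>
      (\<exists>x\<in>I. \<not> nilp x \<and> (\<forall>y\<in>I. \<exists>q\<in>zspan B. nilp (of_int k *s y - x * q))))"
proof -
  obtain N :: "'a \<Rightarrow> rat" and s :: int and \<delta> :: rat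
    where N_mult: "\<And>x y. x \<in> D \<Longrightarrow> y \<in> D \<Longrightarrow> N (x * y) = N x * N y" and N_e: "N e = 1"
      and N_scale: "\<And>q x. x \<in> D \<Longrightarrow> N (q *s x) = q ^ card B * N x"
      and s: "s > 0" and N_int: "\<And>x. x \<in> zspan B \<Longrightarrow> of_int s * N x \<in> \<int>"
      and \<delta>: "\<delta> > 0"
      and N_small: "\<And>x. x \<in> D \<Longrightarrow> (\<forall>b\<in>B. \<bar>representation B x b\<bar> \<le> \<delta>) \<Longrightarrow> \<bar>N x\<bar> < 1"
    using norm_form by blast
  obtain Q :: nat where Q: "Q > 0" "1 / of_nat Q \<le> \<delta>"
  proof -
    obtain m :: nat where "1 / \<delta> < of_nat m"
      using reals_Archimedean2 by blast
    then show ?thesis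
      using \<delta> that[of m] by (cases m) (auto simp: field_simps)
  qed
  \<comment> \<open>\<open>K\<close> bounds every multiplier that the approximation can produce; its
    factorial is divisible by all of them, so one \<open>k\<close> serves all \<open>y\<close> and
    all \<open>I\<close>.\<close>
  define K where "K = Q ^ card B"
  show ?thesis
  proof (intro exI[of _ "fact K :: int"] conjI allI impI)
    fix I
    assume I: "zmodule I \<and> I \<subseteq> D \<and> (\<forall>x\<in>I. \<forall>b\<in>B. x * b \<in> I) \<and>
      (\<exists>n::int. n > 0 \<and> (\<forall>x\<in>I. of_int n *s x \<in> zspan B)) \<and> (\<exists>x\<in>I. \<not> nilp x)"
    then obtain n :: int where n: "n > 0" "\<And>x. x \<in> I \<Longrightarrow> of_int n *s x \<in> zspan B"
      by blast
    \<comment> \<open>On \<open>I\<close> the norm has the common denominator \<open>c\<close>, so a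
      least absolute value exists. This \<open>c\<close> may vary with \<open>I\<close>; it does not
      enter \<open>k\<close>.\<close>
    define c :: rat where "c = of_int s * of_int n ^ card B"
    have c: "c > 0"
      using s n by (simp add: c_def)
    have c_int: "c * \<bar>N x\<bar> \<in> \<int>" if "x \<in> I" for x
    proof -
      have "c * N x = of_int s * N (of_int n *s x)"
        using N_scale[of x] I that by (auto simp: c_def)
      then have "c * N x \<in> \<int>"
        using N_int n(2)[OF that] by simp
      moreover have "c * \<bar>N x\<bar> = \<bar>c * N x\<bar>"
        using c by (simp add: abs_mult)
      ultimately show ?thesis
        by (simp add: abs_if)
    qed
    obtain x where x: "x \<in> I" "\<not> nilp x"
      and min: "\<And>y. y \<in> I \<Longrightarrow> \<not> nilp y \<Longrightarrow> nat \<lfloor>c * \<bar>N x\<bar>\<rfloor> \<le> nat \<lfloor>c * \<bar>N y\<bar>\<rfloor>"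
      using ex_has_least_nat[of "\<lambda>x. x \<in> I \<and> \<not> nilp x" _ "\<lambda>x. nat \<lfloor>c * \<bar>N x\<bar>\<rfloor>"] I by blast
    have min': "\<bar>N x\<bar> \<le> \<bar>N y\<bar>" if y: "y \<in> I" "\<not> nilp y" for y
    proof -
      have "\<lfloor>c * \<bar>N x\<bar>\<rfloor> \<le> \<lfloor>c * \<bar>N y\<bar>\<rfloor>"
        using min[OF y] c by (simp add: nat_le_iff)
      moreover have "of_int \<lfloor>c * \<bar>N x\<bar>\<rfloor> = c * \<bar>N x\<bar>" "of_int \<lfloor>c * \<bar>N y\<bar>\<rfloor> = c * \<bar>N y\<bar>"
        using c_int[OF x(1)] c_int[OF y(1)] by auto
      ultimately have "c * \<bar>N x\<bar> \<le> c * \<bar>N y\<bar>"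
        by (metis of_int_le_iff)
      then show ?thesis
        using c by simp
    qed
    have xD: "x \<in> D"
      using x I by blast
    obtain x' where x': "x' \<in> D" "x * x' = e" "x' * x = e"
      using inverse xD x(2) by blast
    have Nx: "\<bar>N x\<bar> > 0"
      using N_mult[OF xD x'(1)] N_e x'(2) by auto
    have closed: "x * q \<in> I" if "q \<in> zspan B" for q
    proof -
      have "zmodule {q. x * q \<in> I}"
        using I by (auto simp: zmodule_def right_diff_distrib)
      then show ?thesis
        using zspan_minimal[of "{q. x * q \<in> I}" B] x(1) I that by blast
    qed
    have "\<exists>q\<in>zspan B. nilp (of_int (fact K) *s y - x * q)" if y: "y \<in> I" for y
    proof -
      have yD: "y \<in> D"
        using y I by blast
      define z where "z = x' * y"
      have zD: "z \<in> D"
        using x' yD by (simp add: z_def mult_D)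
      obtain t a where t: "t \<in> {1..K}"
        and a: "\<forall>b\<in>B. \<bar>of_nat t * representation B z b - of_int (a b)\<bar> \<le> 1 / of_nat Q"
        using simultaneous_approximation[OF finite_B Q(1), of "representation B z"]
        unfolding K_def by blast
      define q where "q = (\<Sum>b\<in>B. of_int (a b) *s b)"
      have qZ: "q \<in> zspan B"
        unfolding q_def zspan_def by blast
      have qD: "q \<in> D"
        using qZ zspan_subset_span span_minimal[OF B_subset subspace_D] by blast
      define r where "r = of_nat t *s z - q"
      have rD: "r \<in> D"
        unfolding r_def using zD qD subspace_D by (simp add: subspace_diff subspace_scale)
      have q_coord: "representation B q b = of_int (a b)" if "b \<in> B" for b
      proof -
        have "representation B q b = (\<Sum>b'\<in>B. of_int (a b') * (if b = b' then 1 else 0))"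
          unfolding q_def using independent_B
          by (subst representation_sum)
            (auto simp: representation_scale representation_basis span_base span_scale
              intro!: sum.cong)
        also have "\<dots> = (\<Sum>b'\<in>B. if b = b' then of_int (a b') else 0)"
          by (rule sum.cong) auto
        also have "\<dots> = of_int (a b)"
          using that finite_B by simp
        finally show ?thesis .
      qed
      have "representation B r b = of_nat t * representation B z b - of_int (a b)" if "b \<in> B" for b
        unfolding r_def using zD qD D_subset independent_B q_coord[OF that]
        by (simp add: representation_diff representation_scale span_scale subset_iff)
      then have "\<bar>N r\<bar> < 1"
        using a Q(2) by (intro N_small[OF rD]) (force intro: order_trans)
      then have "\<bar>N (x * r)\<bar> < \<bar>N x\<bar>"
        using N_mult[OF xD rD] Nx by (simp add: abs_mult)
      moreover have xr: "x * r = of_nat t *s y - x * q"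
      proof -
        have "x * z = y"
          using x'(2) e_left[OF yD] by (simp add: z_def flip: mult.assoc)
        then show ?thesis
          by (simp add: r_def right_diff_distrib scale_mult_right)
      qed
      moreover have "of_nat t *s y - x * q \<in> I"
        using zmodule_scale[of I y "int t"] closed[OF qZ] y I by (simp add: zmodule_def)
      ultimately have "nilp (of_nat t *s y - x * q)"
        using min'[of "x * r"] by fastforce
      moreover have "t dvd fact K"
        using t by (intro dvd_fact) auto
      then obtain m where m: "fact K = t * m"
        by blast
      have "of_int (fact K) *s y - x * (of_nat m *s q) = of_nat m *s (of_nat t *s y - x * q)"
      proof -
        have "(of_int (fact K) :: rat) = of_nat (fact K)"
          by simp
        also have "\<dots> = of_nat m * of_nat t"
          unfolding m by simp
        finally show ?thesis
          by (simp add: scale_right_diff_distrib scale_mult_right)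
      qed
      ultimately have "nilp (of_int (fact K) *s y - x * (of_nat m *s q))"
        by (simp add: nilp_scale)
      moreover have "of_nat m *s q \<in> zspan B"
        using zmodule_scale[OF zmodule_zspan qZ, of "int m"] by simp
      ultimately show ?thesis by blast
    qed
    then show "\<exists>x\<in>I. \<not> nilp x \<and> (\<forall>y\<in>I. \<exists>q\<in>zspan B. nilp (of_int (fact K) *s y - x * q))"
      using x by blast
  qed simp
qed

end

section \<open>Right modules over an order\<close>

locale fd_order = fd_algebra +
  fixes S \<Lambda> :: "'a set"
  assumes finite_S: "finite S" and \<Lambda>_def: "\<Lambda> = zspan S" and \<Lambda>_A: "\<Lambda> \<subseteq> A" and one_\<Lambda>: "1 \<in> \<Lambda>"
    and mult_\<Lambda>: "\<And>x y. x \<in> \<Lambda> \<Longrightarrow> y \<in> \<Lambda> \<Longrightarrow> x * y \<in> \<Lambda>"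
    and multiple_\<Lambda>: "\<And>x. x \<in> A \<Longrightarrow> \<exists>n::int. n > 0 \<and> of_int n *s x \<in> \<Lambda>"
begin

lemma zmodule_\<Lambda>: "zmodule \<Lambda>"
  unfolding \<Lambda>_def by (rule zmodule_zspan)

lemma in_A: "x \<in> \<Lambda> \<Longrightarrow> x \<in> A"
  using \<Lambda>_A by blast

text \<open>One decomposition of 1 is fixed for the whole locale: its entries are the finite
  alphabet from which all frames draw their idempotents.\<close>

definition prims :: "'a list"
  where "prims = (SOME es. (\<forall>p\<in>set es. prim p) \<and> sum_list es = 1)"

lemma prims: "\<forall>p\<in>set prims. prim p" "sum_list prims = 1"
proof -
  have "\<exists>es. (\<forall>p\<in>set es. prim p) \<and> sum_list es = 1"
    by (rule prim_decomposition[OF one_A]) simp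
  then have "(\<forall>p\<in>set prims. prim p) \<and> sum_list prims = 1"
    unfolding prims_def by (rule someI_ex)
  then show "\<forall>p\<in>set prims. prim p" "sum_list prims = 1"
    by auto
qed

lemma prims_expand: "(\<Sum>l\<leftarrow>prims. x * l) = x"
  using prims(2) sum_list_const_mult[of x "\<lambda>l. l" prims] by simp

lemma zmodule_sum_list: "zmodule Z \<Longrightarrow> (\<And>x. x \<in> set xs \<Longrightarrow> f x \<in> Z) \<Longrightarrow> (\<Sum>x\<leftarrow>xs. f x) \<in> Z"
  by (induction xs) (auto simp: zmodule_add zmodule_def)

lemma zmodule_J: "zmodule J"
  by (simp add: zmodule_def J_zero J_diff)

lemma not_J_prim:
  assumes "x \<notin> J"
  obtains l where "l \<in> set prims" "x * l \<notin> J"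
  using assms zmodule_sum_list[OF zmodule_J, of prims "\<lambda>l. x * l"] prims_expand[of x] by auto

lemma prim_A: "prim e \<Longrightarrow> e \<in> A" and prim_idem: "prim e \<Longrightarrow> e * e = e"
  by (simp_all add: prim_def)

lemma prim_not_nilp:
  assumes "prim e"
  shows "\<not> nilp e"
proof
  assume "nilp e"
  then obtain n where n: "e ^ n = 0"
    unfolding nilp_def by blast
  have "e ^ Suc k = e" for k
    using prim_idem[OF assms] by (induction k) auto
  then show False
    using n assms by (metis mult_zero_right power_Suc prim_def)
qed

text \<open>By definition of \<open>J\<close> some \<open>x * w\<close> is not nilpotent.
  \<open>nilp_swap\<close> moves \<open>w\<close> to the left, and a second use of it allows
  \<open>e\<close> in front, since \<open>x * e = x\<close>.\<close>

lemma not_J_witness: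
  assumes e: "prim e" and x: "x \<in> A" "x * e = x" "x \<notin> J"
  obtains w where "w \<in> A" "e * w = w" "\<not> nilp (w * x)"
proof -
  obtain w where w: "w \<in> A" "\<not> nilp (x * w)"
    using x unfolding J_def by blast
  then have "\<not> nilp (w * x)"
    using nilp_swap by blast
  then have "\<not> nilp (e * (w * x))"
    using nilp_swap[of e "w * x"] x(2) by (auto simp: mult.assoc)
  then show ?thesis
    using that[of "e * w"] w(1) prim_A[OF e] prim_idem[OF e]
    by (simp add: closed_A mult.assoc) (metis mult.assoc)
qed

text \<open>A corner element outside \<open>J\<close> has a nonnilpotent left multiple in the local
  corner, hence a left inverse \<open>g\<close>; then \<open>g ^ n * z ^ n = e\<close> for
  \<open>n > 0\<close> excludes nilpotency. This puts the nilpotent remainders of the division into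
  \<open>J\<close>.\<close>

lemma corner_nilp_J:
  assumes e: "prim e" and z: "z \<in> A" "e * z = z" "z * e = z" "nilp z"
  shows "z \<in> J"
proof (rule ccontr)
  assume "z \<notin> J"
  then obtain w where w: "w \<in> A" "e * w = w" "\<not> nilp (w * z)"
    using not_J_witness[OF e z(1,3)] by blast
  moreover have "w * z \<in> A" "e * (w * z) = w * z" "w * z * e = w * z"
    using w z by (simp_all add: closed_A mult.assoc) (simp flip: mult.assoc)
  ultimately obtain y where y: "y \<in> A" "y * e = y" "y * (w * z) = e"
    using prim_unit[OF e] by metis
  define g where "g = y * w * e"
  have gz: "g * z = e"
    using y z by (simp add: g_def mult.assoc)
  have ge: "g * e = g"
    using prim_idem[OF e] by (simp add: g_def mult.assoc)
  have "g ^ Suc n * z ^ Suc n = e" for n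
  proof (induction n)
    case (Suc n)
    have "g ^ Suc (Suc n) * z ^ Suc (Suc n) = g * (g ^ Suc n * z ^ Suc n) * z"
      by (simp add: mult.assoc power_commutes)
    then show ?case
      using Suc gz ge by simp
  qed (simp add: gz)
  then show False
    using z(4) e unfolding nilp_def prim_def by (metis mult_zero_right power_Suc)
qed

text \<open>Modulo \<open>J\<close>, right multiplication by \<open>l\<close> on \<open>e A\<close>
  is zero or factors through \<open>e\<close>: if \<open>e A l\<close> is not inside
  \<open>J\<close>, an inverse in the local corner of \<open>l\<close> gives
  \<open>l = a * b\<close>. This carries a bound known on \<open>M e\<close> over to
  \<open>M l\<close> for the other primitive idempotents \<open>l\<close>.\<close>

lemma prim_connect:
  assumes e: "prim e" and l: "prim l"
  shows "\<exists>a\<in>A. \<exists>b\<in>A. a * e = a \<and> e * b = b \<and> (\<forall>y\<in>A. e * y = y \<longrightarrow> y * l - y * a * b \<in> J)"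
proof (cases "\<forall>y\<in>A. e * y = y \<longrightarrow> y * l \<in> J")
  case True
  then show ?thesis
    using zero_A by (intro bexI[of _ 0]) auto
next
  case False
  then obtain y where y: "y \<in> A" "e * y = y" "y * l \<notin> J"
    by blast
  have yl: "y * l \<in> A" "y * l * l = y * l"
    using y prim_A[OF l] prim_idem[OF l] by (simp_all add: closed_A mult.assoc)
  then obtain w where w: "w \<in> A" "l * w = w" "\<not> nilp (w * (y * l))"
    using not_J_witness[OF l _ _ y(3)] by blast
  have "w * (y * l) \<in> A" "l * (w * (y * l)) = w * (y * l)" "w * (y * l) * l = w * (y * l)"
    using w yl by (simp_all add: closed_A mult.assoc) (simp flip: mult.assoc)
  then obtain u where u: "u \<in> A" "u * (w * (y * l)) = l"
    using prim_unit[OF l _ _ _ w(3)] by metis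
  have "(u * w * e) * (y * l) = l"
  proof -
    have "(u * w * e) * (y * l) = u * (w * (e * y * l))"
      by (simp add: mult.assoc)
    then show ?thesis
      using u y by simp
  qed
  then have "\<forall>x\<in>A. x * l - x * (u * w * e) * (y * l) \<in> J"
    by (simp add: mult.assoc J_zero)
  moreover have "u * w * e * e = u * w * e" "e * (y * l) = y * l"
    using prim_idem[OF e] y(2) by (simp_all add: mult.assoc) (simp flip: mult.assoc)
  moreover have "u * w * e \<in> A"
    using u w prim_A[OF e] by (simp add: closed_A)
  ultimately show ?thesis
    using yl(1) by blast
qed

section \<open>Right lattices over the order\<close>

definition rmod :: "'a set \<Rightarrow> bool"
  where "rmod M \<longleftrightarrow> zmodule M \<and> M \<subseteq> A \<and> (\<forall>m\<in>M. \<forall>x\<in>\<Lambda>. m * x \<in> M) \<and>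
    (\<exists>n::int. n > 0 \<and> (\<forall>m\<in>M. of_int n *s m \<in> \<Lambda>))"

text \<open>This is \<open>e \<Lambda> + J\<close>, the cyclic lattice blurred by the
  radical.\<close>

definition near :: "'a \<Rightarrow> 'a set"
  where "near e = {y. \<exists>x\<in>\<Lambda>. y - e * x \<in> J}"

lemma zmodule_near: "zmodule (near e)"
  unfolding zmodule_def near_def
proof (intro conjI ballI)
  show "0 \<in> {y. \<exists>x\<in>\<Lambda>. y - e * x \<in> J}"
    using zmodule_\<Lambda> J_zero by (auto simp: zmodule_def intro!: bexI[of _ 0])
  fix y z assume "y \<in> {y. \<exists>x\<in>\<Lambda>. y - e * x \<in> J}" "z \<in> {y. \<exists>x\<in>\<Lambda>. y - e * x \<in> J}"
  then obtain a b where "a \<in> \<Lambda>" "y - e * a \<in> J" "b \<in> \<Lambda>" "z - e * b \<in> J"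
    by blast
  then show "y - z \<in> {y. \<exists>x\<in>\<Lambda>. y - e * x \<in> J}"
    using J_diff[of "y - e * a" "z - e * b"] zmodule_\<Lambda>
    by (auto simp: zmodule_def algebra_simps intro!: bexI[of _ "a - b"])
qed

lemma J_near: "y \<in> J \<Longrightarrow> y \<in> near e"
  unfolding near_def using zmodule_\<Lambda> by (auto simp: zmodule_def intro!: bexI[of _ 0])

lemma near_cong: "y - z \<in> J \<Longrightarrow> z \<in> near e \<Longrightarrow> y \<in> near e"
  using zmodule_add[OF zmodule_near J_near, of "y - z" z e] by simp

lemma common_multiple_zspan:
  assumes "finite I" "finite T" "\<And>i t. i \<in> I \<Longrightarrow> t \<in> T \<Longrightarrow> \<exists>n::int. n > 0 \<and> of_int n *s (t * g i) \<in> Z"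
    "zmodule Z"
  shows "\<exists>n::int. n > 0 \<and> (\<forall>i\<in>I. \<forall>x\<in>zspan T. of_int n *s (x * g i) \<in> Z)"
proof -
  obtain n :: int where n: "n > 0"
    "\<forall>p\<in>I \<times> T. of_int n *s (snd p * g (fst p)) \<in> Z"
    using common_multiple[of "I \<times> T" "\<lambda>p. snd p * g (fst p)" Z] assms by auto
  have "zmodule {x. of_int n *s (x * g i) \<in> Z}" for i
    using assms(4) by (auto simp: zmodule_def left_diff_distrib scale_right_diff_distrib)
  then have "zspan T \<subseteq> {x. of_int n *s (x * g i) \<in> Z}" if "i \<in> I" for i
    using n(2) that by (intro zspan_minimal) auto
  then show ?thesis
    using n(1) by blast
qed

text \<open>Left multiplication by \<open>v\<close> maps \<open>M\<close> into \<open>e A\<close>,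
  \<open>u\<close> splits this map, and \<open>c\<close> bounds how far the image exceeds
  \<open>e \<Lambda>\<close> modulo \<open>J\<close>. A left factor \<open>w\<close> pushes
  \<open>M\<close> into the corner, where lattices are principal up to a fixed factor; the generator
  yields \<open>u\<close>, its inverse yields \<open>v\<close>.\<close>

lemma step_prim:
  assumes e: "prim e"
  shows "\<exists>c::int. c > 0 \<and> (\<forall>M. rmod M \<and> (\<exists>m\<in>M. m * e \<notin> J) \<longrightarrow>
    (\<exists>u\<in>M. \<exists>v\<in>A. u * e = u \<and> e * v = v \<and> v * u = e \<and> (\<forall>m\<in>M. of_int c *s (v * m) \<in> near e)))"
proof -
  define D where "D = {x \<in> A. e * x = x \<and> x * e = x}"
  note eA = prim_A[OF e] and ee = prim_idem[OF e]
  obtain N :: int where N: "N > 0" "of_int N *s e \<in> \<Lambda>"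
    using multiple_\<Lambda>[OF eA] by blast
  \<comment> \<open>\<open>e\<close> need not lie in \<open>\<Lambda>\<close>, so an integral
    multiple of it takes its place.\<close>
  define h where "h = of_int N *s e"
  have h: "h \<in> \<Lambda>" "h \<in> A" "e * h = h" "h * e = h"
    using N in_A ee by (simp_all add: h_def scale_mult_left scale_mult_right)
  \<comment> \<open>The basis \<open>B\<close> of the corner is chosen inside \<open>h S h\<close>
    so that it acts from the right on the lattice \<open>I\<close> built from
    \<open>M\<close>.\<close>
  define S' where "S' = (\<lambda>s. h * s * h) ` S"
  have SL: "S \<subseteq> \<Lambda>"
    using zspan_base[OF finite_S] by (auto simp: \<Lambda>_def)
  have subD: "subspace D"
    unfolding D_def
    by (rule subspaceI) (auto simp: closed_A algebra_simps scale_mult_left scale_mult_right)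
  have hxh: "h * x * h \<in> D" if "x \<in> A" for x
    using that h by (simp add: D_def closed_A mult.assoc) (simp flip: mult.assoc add: h)
  have S'_D: "S' \<subseteq> D"
    unfolding S'_def using hxh SL in_A by blast
  have hxh_span: "h * x * h \<in> span S'" if x: "x \<in> A" for x
  proof -
    have "subspace {x. h * x * h \<in> span S'}"
      by (rule subspaceI)
        (auto simp: algebra_simps scale_mult_left scale_mult_right span_add span_scale span_zero)
    then have "span S \<subseteq> {x. h * x * h \<in> span S'}"
      by (intro span_minimal) (auto simp: S'_def intro: span_base)
    moreover obtain n :: int where n: "n > 0" "of_int n *s x \<in> \<Lambda>"
      using multiple_\<Lambda>[OF x] by blast
    then have "(1 / of_int n) *s (of_int n *s x) \<in> span S"
      using zspan_subset_span unfolding \<Lambda>_def by (blast intro: span_scale)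
    then have "x \<in> span S"
      using n(1) by simp
    ultimately show ?thesis by blast
  qed
  obtain B where B: "B \<subseteq> S'" "independent B" "S' \<subseteq> span B"
    using maximal_independent_subset by blast
  have finB: "finite B"
    using B(1) finite_S finite_subset unfolding S'_def by blast
  have span_S': "span S' \<subseteq> span B"
    using B(3) by (rule span_minimal) simp
  have D_span: "D \<subseteq> span B"
  proof
    fix x assume x: "x \<in> D"
    have "h * x * h = (of_int N * of_int N) *s x"
      using x by (simp add: D_def h_def scale_mult_left scale_mult_right)
    then have "x = (1 / (of_int N * of_int N)) *s (h * x * h)"
      using N(1) by simp
    moreover have "h * x * h \<in> span B"
      using hxh_span span_S' x by (auto simp: D_def)
    ultimately show "x \<in> span B"
      by (metis span_scale)
  qed
  have "x * y \<in> D" if "x \<in> D" "y \<in> D" for x y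
  proof -
    have "e * (x * y) = e * x * y" "x * y * e = x * (y * e)"
      by (simp_all add: mult.assoc)
    then show ?thesis
      using that by (simp add: D_def closed_A)
  qed
  then interpret lattice_algebra scale D B e
    by unfold_locales (use subD B S'_D finB D_span eA ee e in \<open>auto simp: D_def prim_def\<close>)
  have inverse: "\<forall>x\<in>D. \<not> nilp x \<longrightarrow> (\<exists>y\<in>D. x * y = e \<and> y * x = e)"
  proof (intro ballI impI)
    fix x assume x: "x \<in> D" and nn: "\<not> nilp x"
    have "x \<in> A" "e * x = x" "x * e = x"
      using x by (simp_all add: D_def)
    then obtain y where "y \<in> A" "e * y = y" "y * e = y" "x * y = e" "y * x = e"
      by (rule prim_unit[OF e _ _ _ nn])
    then show "\<exists>y\<in>D. x * y = e \<and> y * x = e"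
      by (intro bexI[of _ y]) (simp_all add: D_def)
  qed
  obtain k :: int where k: "k > 0"
    and principal: "\<forall>I. zmodule I \<and> I \<subseteq> D \<and> (\<forall>x\<in>I. \<forall>b\<in>B. x * b \<in> I) \<and>
      (\<exists>n::int. n > 0 \<and> (\<forall>x\<in>I. of_int n *s x \<in> zspan B)) \<and> (\<exists>x\<in>I. \<not> nilp x) \<longrightarrow>
      (\<exists>x\<in>I. \<not> nilp x \<and> (\<forall>y\<in>I. \<exists>q\<in>zspan B. nilp (of_int k *s y - x * q)))"
    using lattice_principal[OF inverse] by (elim exE conjE)
  have "\<exists>n::int. n > 0 \<and> (\<forall>x\<in>zspan S. of_int n *s (h * x * h) \<in> zspan B)"
  proof (rule zspan_bounded[OF finite_S _ _ zmodule_zspan])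
    fix s assume "s \<in> S"
    then show "\<exists>n::int. n > 0 \<and> of_int n *s (h * s * h) \<in> zspan B"
      using SL in_A hxh D_span by (intro span_multiple_zspan[OF finB]) blast
  qed (simp_all add: algebra_simps scale_mult_left scale_mult_right)
  then obtain n1 :: int where n1: "n1 > 0" "\<And>x. x \<in> \<Lambda> \<Longrightarrow> of_int n1 *s (h * x * h) \<in> zspan B"
    unfolding \<Lambda>_def by blast
  have "\<forall>l\<in>set prims. \<exists>a b. a \<in> A \<and> b \<in> A \<and> a * e = a \<and> e * b = b \<and>
      (\<forall>y\<in>A. e * y = y \<longrightarrow> y * l - y * a * b \<in> J)"
    using prim_connect[OF e] prims(1) by blast
  from bchoice[OF this] obtain a where "\<forall>l\<in>set prims. \<exists>b. a l \<in> A \<and> b \<in> A \<and> a l * e = a l \<and>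
      e * b = b \<and> (\<forall>y\<in>A. e * y = y \<longrightarrow> y * l - y * a l * b \<in> J)" ..
  from bchoice[OF this] obtain b where "\<forall>l\<in>set prims. a l \<in> A \<and> b l \<in> A \<and> a l * e = a l \<and>
      e * b l = b l \<and> (\<forall>y\<in>A. e * y = y \<longrightarrow> y * l - y * a l * b l \<in> J)" ..
  then have ab: "\<And>l. l \<in> set prims \<Longrightarrow> a l \<in> A" "\<And>l. l \<in> set prims \<Longrightarrow> b l \<in> A"
      "\<And>l. l \<in> set prims \<Longrightarrow> a l * e = a l" "\<And>l. l \<in> set prims \<Longrightarrow> e * b l = b l"
      "\<And>l y. l \<in> set prims \<Longrightarrow> y \<in> A \<Longrightarrow> e * y = y \<Longrightarrow> y * l - y * a l * b l \<in> J"
    by simp_all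
  have "\<exists>n::int. n > 0 \<and> (\<forall>l\<in>set prims. of_int n *s a l \<in> \<Lambda>)"
    by (rule common_multiple[OF _ _ zmodule_\<Lambda>]) (use ab(1) multiple_\<Lambda> in auto)
  then obtain n2 :: int where n2: "n2 > 0" "\<And>l. l \<in> set prims \<Longrightarrow> of_int n2 *s a l \<in> \<Lambda>"
    by blast
  have "\<exists>n::int. n > 0 \<and> (\<forall>l\<in>set prims. \<forall>x\<in>zspan B. of_int n *s (x * b l) \<in> near e)"
  proof (rule common_multiple_zspan[OF _ finB _ zmodule_near])
    fix l x assume l: "l \<in> set prims" and x: "x \<in> B"
    have xD: "x \<in> D"
      using x B(1) S'_D by blast
    then obtain n :: int where n: "n > 0" "of_int n *s (x * b l) \<in> \<Lambda>"
      using multiple_\<Lambda>[of "x * b l"] ab(2)[OF l] by (auto simp: D_def closed_A)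
    have "e * (of_int n *s (x * b l)) = of_int n *s (x * b l)"
      using xD by (simp add: D_def scale_mult_right flip: mult.assoc)
    then show "\<exists>n::int. n > 0 \<and> of_int n *s (x * b l) \<in> near e"
      using n J_zero unfolding near_def by (intro exI[of _ n]) force
  qed simp
  then obtain n3 :: int where n3: "n3 > 0"
    "\<And>l x. l \<in> set prims \<Longrightarrow> x \<in> zspan B \<Longrightarrow> of_int n3 *s (x * b l) \<in> near e"
    by blast
  \<comment> \<open>\<open>n2\<close> makes each \<open>a l\<close> integral, \<open>N\<close> pays
    for \<open>h\<close> in place of \<open>e\<close>, \<open>k\<close> for the principal
    approximation and \<open>n3\<close> for the \<open>b l\<close>. None of them depends on
    \<open>M\<close>.\<close>
  define c where "c = n3 * (k * (N * n2))"
  show ?thesis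
  proof (intro exI[of _ c] conjI allI impI)
    show "c > 0"
      using n3 k N n2 by (simp add: c_def)
    fix M assume M: "rmod M \<and> (\<exists>m\<in>M. m * e \<notin> J)"
    then have MA: "\<And>m. m \<in> M \<Longrightarrow> m \<in> A" and Mz: "zmodule M"
      and M_mult: "\<And>m x. m \<in> M \<Longrightarrow> x \<in> \<Lambda> \<Longrightarrow> m * x \<in> M"
      by (auto simp: rmod_def)
    obtain n4 :: int where n4: "n4 > 0" "\<And>m. m \<in> M \<Longrightarrow> of_int n4 *s m \<in> \<Lambda>"
      using M unfolding rmod_def by blast
    obtain m0 where m0: "m0 \<in> M" "m0 * e \<notin> J"
      using M by blast
    obtain w where w: "w \<in> A" "e * w = w" "\<not> nilp (w * (m0 * e))"
      using not_J_witness[OF e, of "m0 * e"] m0 MA eA ee by (auto simp: closed_A mult.assoc)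
    obtain n5 :: int where n5: "n5 > 0" "of_int n5 *s w \<in> \<Lambda>"
      using multiple_\<Lambda>[OF w(1)] by blast
    \<comment> \<open>\<open>w\<close> on the left and \<open>h\<close> on the right put
      \<open>M\<close> into the corner \<open>D\<close>. Since \<open>B\<close> lies in
      \<open>h S h\<close>, it acts on \<open>I\<close> through the action of
      \<open>\<Lambda>\<close> on \<open>M\<close>.\<close>
    define I where "I = (\<lambda>m. w * m * h) ` M"
    have "zmodule I"
      unfolding zmodule_def
    proof (intro conjI ballI)
      show "0 \<in> I"
        using Mz by (force simp: I_def zmodule_def)
      fix x y assume "x \<in> I" "y \<in> I"
      then obtain m m' where m: "m \<in> M" "m' \<in> M" "x = w * m * h" "y = w * m' * h"
        unfolding I_def by blast
      then have "x - y = w * (m - m') * h" "m - m' \<in> M"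
        using Mz by (auto simp: algebra_simps zmodule_def)
      then show "x - y \<in> I"
        unfolding I_def by blast
    qed
    moreover have I_D: "I \<subseteq> D"
    proof
      fix x assume "x \<in> I"
      then obtain m where m: "m \<in> M" "x = w * m * h"
        unfolding I_def by blast
      have "e * (w * m * h) = w * m * h"
        using w(2) by (simp flip: mult.assoc)
      then show "x \<in> D"
        using m w h MA by (simp add: D_def closed_A mult.assoc)
    qed
    moreover have "\<forall>x\<in>I. \<forall>b\<in>B. x * b \<in> I"
    proof (intro ballI)
      fix x t assume "x \<in> I" "t \<in> B"
      then obtain m s where m: "m \<in> M" "x = w * m * h" and s: "s \<in> S" "t = h * s * h"
        using B(1) unfolding I_def S'_def by blast
      have "x * t = w * (m * (h * h * s)) * h"
        by (simp add: m s mult.assoc)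
      moreover have "m * (h * h * s) \<in> M"
        using m s SL h by (intro M_mult mult_\<Lambda>) auto
      ultimately show "x * t \<in> I"
        unfolding I_def by blast
    qed
    moreover have "\<exists>n::int. n > 0 \<and> (\<forall>x\<in>I. of_int n *s x \<in> zspan B)"
    proof (intro exI[of _ "n1 * (n4 * n5) * N"] conjI ballI)
      fix x assume "x \<in> I"
      then obtain m where m: "m \<in> M" "x = w * m * h"
        unfolding I_def by blast
      have "h * (w * m) * h = of_int N *s x"
        unfolding m(2) using w(2)
        by (subst (1) h_def) (simp add: scale_mult_left flip: mult.assoc)
      then have "of_int (n1 * (n4 * n5) * N) *s x = of_int n1 *s (h * ((of_int n5 *s w) * (of_int n4 *s m)) * h)"
        by (simp add: scale_mult_left scale_mult_right mult.assoc mult_ac)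
      then show "of_int (n1 * (n4 * n5) * N) *s x \<in> zspan B"
        using n1(2) n5(2) n4(2)[OF m(1)] mult_\<Lambda> by simp
    qed (use n1 n4 n5 N in simp)
    moreover have "\<exists>x\<in>I. \<not> nilp x"
    proof (intro bexI)
      have "w * (m0 * e) = (1 / of_int N) *s (w * m0 * h)"
        using N(1) by (simp add: h_def scale_mult_right mult.assoc)
      then show "\<not> nilp (w * m0 * h)"
        using w(3) nilp_scale by metis
      show "w * m0 * h \<in> I"
        using m0 by (simp add: I_def)
    qed
    ultimately have "\<exists>x\<in>I. \<not> nilp x \<and> (\<forall>y\<in>I. \<exists>q\<in>zspan B. nilp (of_int k *s y - x * q))"
      by (intro principal[THEN spec, THEN mp] conjI)
    then obtain x where x: "x \<in> I" "\<not> nilp x"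
      and xq: "\<And>y. y \<in> I \<Longrightarrow> \<exists>q\<in>zspan B. nilp (of_int k *s y - x * q)"
      by blast
    obtain x' where x': "x' \<in> D" "x * x' = e" "x' * x = e"
      using inverse x I_D by blast
    obtain m1 where m1: "m1 \<in> M" "x = w * m1 * h"
      using x(1) unfolding I_def by blast
    \<comment> \<open>The generator is \<open>x = w * u\<close>, so \<open>w\<close> followed by the
      inverse of \<open>x\<close> is a left inverse of \<open>u\<close>.\<close>
    define u where "u = m1 * h"
    define v where "v = x' * w"
    have u: "u \<in> M" "u * e = u"
      using m1 h M_mult by (simp_all add: u_def mult.assoc)
    have v: "v \<in> A" "e * v = v"
      using x'(1) w by (simp_all add: v_def D_def closed_A flip: mult.assoc)
    have vu: "v * u = e"
      using x'(3) m1(2) by (simp add: u_def v_def mult.assoc)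
    have key: "\<exists>q\<in>zspan B. of_int k *s (v * m * h) - q \<in> J" if m: "m \<in> M" for m
    proof -
      have y: "w * m * h \<in> I"
        using m by (simp add: I_def)
      then obtain q where q: "q \<in> zspan B" "nilp (of_int k *s (w * m * h) - x * q)"
        using xq by blast
      have qD: "q \<in> D"
        using q zspan_subset_span span_minimal[OF B_subset subspace_D] by blast
      have "of_int k *s (w * m * h) - x * q \<in> D"
        using y I_D x(1) qD subspace_diff[OF subD subspace_scale[OF subD] mult_D] by blast
      then have "of_int k *s (w * m * h) - x * q \<in> J"
        using corner_nilp_J[OF e] q(2) by (simp add: D_def)
      then have "x' * (of_int k *s (w * m * h) - x * q) \<in> J"
        using x'(1) by (intro J_mult_left) (auto simp: D_def)
      also have "x' * (of_int k *s (w * m * h) - x * q) = of_int k *s (v * m * h) - q"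
        using x'(3) qD
        by (simp add: right_diff_distrib scale_mult_right v_def D_def mult.assoc)
          (simp flip: mult.assoc)
      finally show ?thesis
        using q(1) by blast
    qed
    have "of_int c *s (v * m) \<in> near e" if m: "m \<in> M" for m
    proof -
      have vm: "v * m \<in> A" "e * (v * m) = v * m"
        using v MA[OF m] by (simp_all add: closed_A flip: mult.assoc)
      \<comment> \<open>\<open>key\<close> controls only products ending in \<open>h\<close>. Modulo
        \<open>J\<close>, \<open>v * m * l\<close> is \<open>v * m * a l * b l\<close>, where
        \<open>m * a l\<close> ends in \<open>e\<close>; summing over the decomposition of 1
        recovers \<open>v * m\<close>.\<close>
      have "of_int c *s (v * m * l) \<in> near e" if l: "l \<in> set prims" for l
      proof -
        have "m * (of_int n2 *s a l) \<in> M"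
          using m n2(2)[OF l] by (rule M_mult)
        then obtain q where q: "q \<in> zspan B" "of_int k *s (v * (m * (of_int n2 *s a l)) * h) - q \<in> J"
          using key by blast
        have "of_int k *s (v * (m * (of_int n2 *s a l)) * h) = of_int (k * (N * n2)) *s (v * m * a l)"
        proof -
          have "a l * h = of_int N *s a l"
            using ab(3)[OF l] by (simp add: h_def scale_mult_right)
          then show ?thesis
            by (simp add: scale_mult_left scale_mult_right mult.assoc mult_ac)
        qed
        then have "(of_int (k * (N * n2)) *s (v * m * a l) - q) * b l \<in> J"
          using q(2) J_mult_right ab(2)[OF l] by simp
        then have "of_int n3 *s (of_int (k * (N * n2)) *s (v * m * a l * b l) - q * b l) \<in> J"
          by (intro J_scale) (simp add: left_diff_distrib scale_mult_left)
        then have "of_int c *s (v * m * a l * b l) - of_int n3 *s (q * b l) \<in> J"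
          by (simp add: c_def scale_right_diff_distrib)
        then have "of_int c *s (v * m * a l * b l) \<in> near e"
          using near_cong n3(2)[OF l q(1)] by blast
        moreover have "of_int c *s (v * m * l) - of_int c *s (v * m * a l * b l) \<in> J"
          using J_scale[OF ab(5)[OF l vm]] by (simp add: scale_right_diff_distrib)
        ultimately show ?thesis
          using near_cong by blast
      qed
      then have "(\<Sum>l\<leftarrow>prims. (of_int c *s (v * m)) * l) \<in> near e"
        by (intro zmodule_sum_list zmodule_near) (simp add: scale_mult_left)
      then show ?thesis
        by (simp only: prims_expand)
    qed
    then show "\<exists>u\<in>M. \<exists>v\<in>A. u * e = u \<and> e * v = v \<and> v * u = e \<and> (\<forall>m\<in>M. of_int c *s (v * m) \<in> near e)"
      using u v vu by blast
  qed
qed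

text \<open>The product of the finitely many constants serves every entry of \<open>prims\<close>.
  If \<open>M\<close> is not inside \<open>J\<close>, neither is \<open>M e\<close> for some entry
  \<open>e\<close>, because the entries sum to 1.\<close>

lemma step:
  obtains c :: int where "c > 0"
    and "\<And>M. rmod M \<Longrightarrow> \<not> M \<subseteq> J \<Longrightarrow>
      \<exists>e\<in>set prims. \<exists>u\<in>M. \<exists>v\<in>A. u * e = u \<and> e * v = v \<and> v * u = e \<and> (\<forall>m\<in>M. of_int c *s (v * m) \<in> near e)"
proof -
  define Q where "Q e c \<longleftrightarrow> c > 0 \<and> (\<forall>M. rmod M \<and> (\<exists>m\<in>M. m * e \<notin> J) \<longrightarrow>
    (\<exists>u\<in>M. \<exists>v\<in>A. u * e = u \<and> e * v = v \<and> v * u = e \<and> (\<forall>m\<in>M. of_int c *s (v * m) \<in> near e)))"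
    for e and c :: int
  have "\<forall>e\<in>set prims. \<exists>c. Q e c"
    using step_prim prims(1) unfolding Q_def by blast
  from bchoice[OF this] obtain f where f: "\<forall>e\<in>set prims. Q e (f e)" ..
  define c where "c = (\<Prod>e\<in>set prims. f e)"
  show ?thesis
  proof
    show "c > 0"
      unfolding c_def using f by (intro prod_pos) (auto simp: Q_def)
    fix M assume M: "rmod M" "\<not> M \<subseteq> J"
    then obtain m e where e: "m \<in> M" "e \<in> set prims" "m * e \<notin> J"
      using not_J_prim by blast
    then obtain u v where uv: "u \<in> M" "v \<in> A" "u * e = u" "e * v = v" "v * u = e"
      "\<forall>m\<in>M. of_int (f e) *s (v * m) \<in> near e"
      using f M(1) unfolding Q_def by meson
    have "f e dvd c"
      unfolding c_def using e(2) by (intro dvd_prodI) auto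
    then obtain r where r: "c = r * f e"
      by (metis dvdE mult.commute)
    have "\<forall>m\<in>M. of_int c *s (v * m) \<in> near e"
    proof
      fix m assume "m \<in> M"
      then have "of_int r *s (of_int (f e) *s (v * m)) \<in> near e"
        using uv(6) zmodule_scale[OF zmodule_near] by blast
      then show "of_int c *s (v * m) \<in> near e"
        by (simp add: r)
    qed
    then show "\<exists>e\<in>set prims. \<exists>u\<in>M. \<exists>v\<in>A. u * e = u \<and> e * v = v \<and> v * u = e \<and>
        (\<forall>m\<in>M. of_int c *s (v * m) \<in> near e)"
      using uv e(2) by blast
  qed
qed

section \<open>Frames: coordinates modulo the radical\<close>

text \<open>
  Modulo \<open>J\<close>, the maps \<open>v i\<close> embed \<open>M\<close> into the sum of the modules \<open>(1/c) e i \<Lambda>\<close>, the maps \<open>u i\<close> invert this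
  embedding, and the image contains \<open>C\<close> times the sum of the modules \<open>e i \<Lambda>\<close>.
\<close>

definition frame :: "'a set \<Rightarrow> int \<Rightarrow> int \<Rightarrow> nat \<Rightarrow> (nat \<Rightarrow> 'a) \<Rightarrow> (nat \<Rightarrow> 'a) \<Rightarrow> (nat \<Rightarrow> 'a) \<Rightarrow> bool"
  where "frame M c C n e u v \<longleftrightarrow>
    (\<forall>i<n. e i \<in> set prims \<and> u i \<in> A \<and> v i \<in> A \<and> u i * e i = u i \<and> e i * v i = v i) \<and>
    (\<forall>m\<in>M. m - (\<Sum>i<n. u i * (v i * m)) \<in> J) \<and>
    (\<forall>i<n. \<forall>m\<in>M. of_int c *s (v i * m) \<in> near (e i)) \<and>
    (\<forall>i<n. \<forall>x\<in>\<Lambda>. \<exists>m\<in>M. of_int C *s (u i * x) - m \<in> J) \<and>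
    (\<forall>i<n. \<forall>j<n. v i * u j - (if i = j then e i else 0) \<in> J)"

text \<open>Split off one summand and continue with \<open>M1\<close>, the image of \<open>M\<close>
  under \<open>1 - u0 * v0\<close>. The dimension of the span of \<open>M\<close> and
  \<open>J\<close> drops, since \<open>v0\<close> maps the span of \<open>M1\<close> and
  \<open>J\<close> into \<open>J\<close> but maps \<open>u0\<close> to \<open>e0\<close>, which is
  not in \<open>J\<close>. Each splitting costs a factor \<open>c\<close>, hence
  \<open>c ^ n\<close>.\<close>

lemma frame_exists:
  fixes c :: int
  assumes c: "c > 0"
    and step: "\<And>M. rmod M \<Longrightarrow> \<not> M \<subseteq> J \<Longrightarrow>
      \<exists>e\<in>set prims. \<exists>u\<in>M. \<exists>v\<in>A. u * e = u \<and> e * v = v \<and> v * u = e \<and> (\<forall>m\<in>M. of_int c *s (v * m) \<in> near e)"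
    and "rmod M"
  shows "\<exists>n e u v. n \<le> dim (span (M \<union> J)) \<and> frame M c (c ^ n) n e u v"
  using assms(3)
proof (induction "dim (span (M \<union> J))" arbitrary: M rule: less_induct)
  case less
  note M = less.prems
  have MA: "m \<in> A" if "m \<in> M" for m
    using M that by (auto simp: rmod_def)
  have Mz: "zmodule M"
    using M by (simp add: rmod_def)
  show ?case
  proof (cases "M \<subseteq> J")
    case True
    then have "frame M c (c ^ 0) 0 e u v" for e u v
      by (auto simp: frame_def)
    then show ?thesis
      by blast
  next
    case False
    then obtain e0 u0 v0 where e0: "e0 \<in> set prims" and u0: "u0 \<in> M" "u0 * e0 = u0"
      and v0: "v0 \<in> A" "e0 * v0 = v0" "v0 * u0 = e0" "\<And>m. m \<in> M \<Longrightarrow> of_int c *s (v0 * m) \<in> near e0"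
      using step[OF M False] by blast
    have e0p: "prim e0"
      using e0 prims(1) by blast
    note e0A = prim_A[OF e0p] and e0e0 = prim_idem[OF e0p]
    have u0A: "u0 \<in> A"
      using u0 MA by blast
    define p where "p m = m - u0 * (v0 * m)" for m
    have v0p: "v0 * p m = 0" for m
    proof -
      have "v0 * (u0 * (v0 * m)) = v0 * m"
      proof -
        have "v0 * (u0 * (v0 * m)) = (v0 * u0) * v0 * m"
          by (simp only: mult.assoc)
        then show ?thesis
          using v0(2,3) by simp
      qed
      then show ?thesis by (simp add: p_def right_diff_distrib)
    qed
    define M1 where "M1 = p ` M"
    have M1: "rmod M1"
      unfolding rmod_def
    proof (intro conjI ballI)
      show "zmodule M1"
        unfolding zmodule_def
      proof (intro conjI ballI)
        show "0 \<in> M1"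
          using Mz unfolding M1_def zmodule_def by (intro image_eqI[of _ _ 0]) (simp_all add: p_def)
        fix x y assume "x \<in> M1" "y \<in> M1"
        then obtain m m' where m: "m \<in> M" "m' \<in> M" "x = p m" "y = p m'"
          unfolding M1_def by blast
        then have "x - y = p (m - m')" "m - m' \<in> M"
          using Mz by (simp_all add: p_def algebra_simps zmodule_def)
        then show "x - y \<in> M1"
          unfolding M1_def by blast
      qed
      show "M1 \<subseteq> A"
        unfolding M1_def p_def using MA u0A v0 by (auto simp: closed_A)
      fix x y assume "x \<in> M1" "y \<in> \<Lambda>"
      then obtain m where m: "m \<in> M" "x = p m"
        unfolding M1_def by blast
      then have "x * y = p (m * y)" "m * y \<in> M"
        using M \<open>y \<in> \<Lambda>\<close> by (simp_all add: p_def left_diff_distrib mult.assoc rmod_def)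
      then show "x * y \<in> M1"
        unfolding M1_def by blast
    next
      obtain n1 :: int where n1: "n1 > 0" "\<forall>m\<in>M. of_int n1 *s m \<in> \<Lambda>"
        using M unfolding rmod_def by blast
      obtain n2 :: int where n2: "n2 > 0" "of_int n2 *s (1 - u0 * v0) \<in> \<Lambda>"
        using multiple_\<Lambda>[of "1 - u0 * v0"] u0A v0 by (auto simp: closed_A)
      have "of_int (n1 * n2) *s p m \<in> \<Lambda>" if "m \<in> M" for m
      proof -
        have "of_int (n1 * n2) *s p m = (of_int n2 *s (1 - u0 * v0)) * (of_int n1 *s m)"
          by (simp add: p_def scale_mult_left scale_mult_right left_diff_distrib mult.assoc mult_ac)
        then show ?thesis
          using n1 n2 that mult_\<Lambda> by simp
      qed
      then show "\<exists>n::int. n > 0 \<and> (\<forall>m\<in>M1. of_int n *s m \<in> \<Lambda>)"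
        unfolding M1_def using n1 n2 by (intro exI[of _ "n1 * n2"]) auto
    qed
    have "M \<union> J \<subseteq> A"
      using MA J_A by blast
    then have W_span: "span (M \<union> J) \<subseteq> span F"
      using span_minimal[OF _ subspace_A] A_span by blast
    \<comment> \<open>\<open>M1\<close> need not be contained in \<open>M\<close>: modulo
      \<open>J\<close>, \<open>u0 * (v0 * m)\<close> is known to be in \<open>M\<close> only after
      multiplication by \<open>c\<close>.\<close>
    have M1_sub: "M1 \<subseteq> span (M \<union> J)"
    proof
      fix x assume "x \<in> M1"
      then obtain m where m: "m \<in> M" "x = p m"
        unfolding M1_def by blast
      obtain y where y: "y \<in> \<Lambda>" "of_int c *s (v0 * m) - e0 * y \<in> J"
        using v0(4)[OF m(1)] unfolding near_def by blast
      have "u0 * (of_int c *s (v0 * m) - e0 * y) \<in> J"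
        using y(2) u0A by (rule J_mult_left)
      moreover have "u0 * (e0 * y) \<in> M"
        using u0 y(1) M by (simp add: rmod_def flip: mult.assoc)
      ultimately have "u0 * (of_int c *s (v0 * m) - e0 * y) + u0 * (e0 * y) \<in> span (M \<union> J)"
        by (intro span_add span_base) auto
      then have "of_int c *s (u0 * (v0 * m)) \<in> span (M \<union> J)"
        by (simp add: right_diff_distrib scale_mult_right)
      from span_scale[OF this, of "1 / of_int c"] have "u0 * (v0 * m) \<in> span (M \<union> J)"
        using c by simp
      then show "x \<in> span (M \<union> J)"
        using span_diff[OF span_base[of m "M \<union> J"]] m(1) by (simp add: m(2) p_def)
    qed
    have "span (M1 \<union> J) \<subseteq> span (M \<union> J)"
      using M1_sub span_base by (intro span_minimal) auto
    moreover have "u0 \<notin> span (M1 \<union> J)"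
    proof
      assume u: "u0 \<in> span (M1 \<union> J)"
      have "subspace {x. v0 * x \<in> J}"
        by (rule subspaceI) (auto simp: J_zero J_add J_scale distrib_left scale_mult_right)
      then have "span (M1 \<union> J) \<subseteq> {x. v0 * x \<in> J}"
        using v0p v0(1) by (intro span_minimal) (auto simp: M1_def J_zero J_mult_left)
      then have "e0 \<in> J"
        using u v0(3) by auto
      then show False
        using J_nilp prim_not_nilp[OF e0p] by blast
    qed
    moreover have "u0 \<in> span (M \<union> J)"
      using u0 span_base by blast
    ultimately have decrease: "dim (span (M1 \<union> J)) < dim (span (M \<union> J))"
      by (intro dim_strict_mono[OF finite_F W_span]) auto
    obtain n e u v where n: "n \<le> dim (span (M1 \<union> J))" and fr: "frame M1 c (c ^ n) n e u v"
      using less.hyps[OF decrease M1] by blast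
    have fr1: "\<And>i. i < n \<Longrightarrow> e i \<in> set prims" "\<And>i. i < n \<Longrightarrow> u i \<in> A" "\<And>i. i < n \<Longrightarrow> v i \<in> A"
      "\<And>i. i < n \<Longrightarrow> u i * e i = u i" "\<And>i. i < n \<Longrightarrow> e i * v i = v i"
      and fr2: "\<And>m. m \<in> M1 \<Longrightarrow> m - (\<Sum>i<n. u i * (v i * m)) \<in> J"
      and fr3: "\<And>i m. i < n \<Longrightarrow> m \<in> M1 \<Longrightarrow> of_int c *s (v i * m) \<in> near (e i)"
      and fr4: "\<And>i x. i < n \<Longrightarrow> x \<in> \<Lambda> \<Longrightarrow> \<exists>m\<in>M1. of_int (c ^ n) *s (u i * x) - m \<in> J"
      and fr5: "\<And>i j. i < n \<Longrightarrow> j < n \<Longrightarrow> v i * u j - (if i = j then e i else 0) \<in> J"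
      using fr by (auto simp: frame_def)
    \<comment> \<open>Modulo \<open>J\<close> a multiple of \<open>u i\<close> comes from
      \<open>M1\<close>, which \<open>v0\<close> annihilates.\<close>
    have v0u: "v0 * u i \<in> J" if i: "i < n" for i
    proof -
      obtain m where m: "m \<in> M1" "of_int (c ^ n) *s (u i * 1) - m \<in> J"
        using fr4[OF i one_\<Lambda>] by blast
      then have "v0 * m = 0"
        unfolding M1_def using v0p by blast
      then have "of_int (c ^ n) *s (v0 * u i) \<in> J"
        using J_mult_left[OF m(2) v0(1)] by (simp add: right_diff_distrib scale_mult_right)
      then have "(1 / of_int (c ^ n)) *s (of_int (c ^ n) *s (v0 * u i)) \<in> J"
        by (rule J_scale)
      then show ?thesis
        using c by simp
    qed
    define e' where "e' = case_nat e0 e"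
    define u' where "u' = case_nat u0 u"
    \<comment> \<open>The later coordinates are composed with the projection
      \<open>1 - u0 * v0\<close>, which makes them vanish on \<open>u0\<close>.\<close>
    define v' where "v' = case_nat v0 (\<lambda>i. v i * (1 - u0 * v0))"
    have simps: "e' 0 = e0" "u' 0 = u0" "v' 0 = v0" "\<And>i. e' (Suc i) = e i" "\<And>i. u' (Suc i) = u i"
      "\<And>i. v' (Suc i) = v i * (1 - u0 * v0)"
      by (simp_all add: e'_def u'_def v'_def)
    have v'm: "v' (Suc i) * m = v i * p m" for i m
      by (simp add: simps p_def algebra_simps)
    have "frame M c (c ^ Suc n) (Suc n) e' u' v'"
      unfolding frame_def
    proof (intro conjI allI impI ballI)
      fix i assume i: "i < Suc n"
      show "e' i \<in> set prims" "u' i \<in> A" "v' i \<in> A" "u' i * e' i = u' i" "e' i * v' i = v' i"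
        using i e0 u0 u0A v0 fr1 by (cases i; simp add: simps closed_A flip: mult.assoc)+
      show "of_int c *s (v' i * m) \<in> near (e' i)" if m: "m \<in> M" for m
        using i v0(4)[OF m] fr3[of _ "p m"] m
        by (cases i) (auto simp: v'm simp del: simps(6), auto simp: simps M1_def)
      show "\<exists>m\<in>M. of_int (c ^ Suc n) *s (u' i * x) - m \<in> J" if x: "x \<in> \<Lambda>" for x
      proof (cases i)
        case 0
        have "of_int (c ^ Suc n) *s (u0 * x) \<in> M"
          using M u0 x by (intro zmodule_scale[OF Mz]) (auto simp: rmod_def)
        then show ?thesis
          using J_zero 0 by (intro bexI[of _ "of_int (c ^ Suc n) *s (u0 * x)"]) (simp_all add: simps)
      next
        case (Suc j)
        then obtain m where m: "m \<in> M" "of_int (c ^ n) *s (u j * x) - p m \<in> J"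
          using fr4[of j x] i x unfolding M1_def by auto
        obtain y where y: "y \<in> \<Lambda>" "of_int c *s (v0 * m) - e0 * y \<in> J"
          using v0(4)[OF m(1)] unfolding near_def by blast
        \<comment> \<open>Modulo \<open>J\<close> this is \<open>c\<close> times \<open>p m\<close>,
          and unlike \<open>p m\<close> it is certain to lie in \<open>M\<close>; here the next
          factor \<open>c\<close> enters.\<close>
        define m' where "m' = of_int c *s m - u0 * y"
        have "m' \<in> M"
          using m(1) u0(1) y(1) M zmodule_scale[OF Mz m(1), of c]
          by (auto simp: m'_def rmod_def zmodule_def)
        moreover have "of_int (c ^ Suc n) *s (u' i * x) - m'
            = of_int c *s (of_int (c ^ n) *s (u j * x) - p m) - u0 * (of_int c *s (v0 * m) - e0 * y)"
        proof -
          have "u0 * (e0 * y) = u0 * y"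
            using u0(2) by (simp flip: mult.assoc)
          then show ?thesis
            by (simp add: Suc simps m'_def p_def scale_right_diff_distrib right_diff_distrib
                scale_mult_right)
        qed
        then have "of_int (c ^ Suc n) *s (u' i * x) - m' \<in> J"
          using J_diff[OF J_scale[OF m(2)] J_mult_left[OF y(2) u0A]] by simp
        ultimately show ?thesis by blast
      qed
      fix j assume j: "j < Suc n"
      show "v' i * u' j - (if i = j then e' i else 0) \<in> J"
      proof (cases i)
        case 0
        then show ?thesis
          using j v0(3) v0u J_zero by (cases j) (auto simp: simps)
      next
        case (Suc i')
        show ?thesis
        proof (cases j)
          case 0
          have "v' i * u' j = 0"
            using u0(2) v0(3) by (simp add: Suc 0 simps algebra_simps mult.assoc)
          then show ?thesis
            using Suc 0 J_zero by simp
        next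
          case (Suc j')
          have ij: "i' < n" "j' < n"
            using i j \<open>i = Suc i'\<close> Suc by auto
          have "v i' * u0 \<in> A"
            using fr1(3)[OF ij(1)] u0A by (rule mult_A)
          then have "v i' * u j' - (if i' = j' then e i' else 0) - v i' * u0 * (v0 * u j') \<in> J"
            by (rule J_diff[OF fr5[OF ij] J_mult_left[OF v0u[OF ij(2)]]])
          then show ?thesis
            using \<open>i = Suc i'\<close> Suc by (cases "i' = j'") (simp_all add: simps algebra_simps)
        qed
      qed
    next
      fix m assume m: "m \<in> M"
      have "m - (\<Sum>i<Suc n. u' i * (v' i * m)) = p m - (\<Sum>i<n. u i * (v i * p m))"
        by (simp only: sum.lessThan_Suc_shift v'm) (simp add: simps p_def)
      then show "m - (\<Sum>i<Suc n. u' i * (v' i * m)) \<in> J"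
        using fr2[of "p m"] m by (simp add: M1_def)
    qed
    then show ?thesis
      using n decrease by (intro exI[of _ "Suc n"]) auto
  qed
qed

text \<open>Passing to a multiple of \<open>C\<close> weakens the condition. It brings frames of
  different lengths, whose constants are different powers of \<open>c\<close>, to one
  constant.\<close>

lemma frame_multiple:
  assumes "frame M c C n e u v" "zmodule M"
  shows "frame M c (r * C) n e u v"
  unfolding frame_def
proof (intro conjI)
  show "\<forall>i<n. \<forall>x\<in>\<Lambda>. \<exists>m\<in>M. of_int (r * C) *s (u i * x) - m \<in> J"
  proof (intro allI impI ballI)
    fix i x assume "i < n" "x \<in> \<Lambda>"
    then obtain m where m: "m \<in> M" "of_int C *s (u i * x) - m \<in> J"
      using assms(1) unfolding frame_def by blast
    then show "\<exists>m\<in>M. of_int (r * C) *s (u i * x) - m \<in> J"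
      using J_scale[OF m(2), of "of_int r"] zmodule_scale[OF assms(2) m(1), of r]
      by (auto simp: scale_right_diff_distrib)
  qed
qed (use assms(1) in \<open>auto simp: frame_def\<close>)

lemma frame_apply:
  assumes "frame M c C n e u v" "m \<in> M" "\<forall>i<n. v i * m - x i \<in> J"
  shows "(\<Sum>i<n. u i * x i) - m \<in> J"
proof -
  have "m - (\<Sum>i<n. u i * (v i * m)) \<in> J" and uA: "i < n \<Longrightarrow> u i \<in> A" for i
    using assms(1,2) by (auto simp: frame_def)
  moreover have "(\<Sum>i<n. u i * (v i * m - x i)) \<in> J"
    using assms(3) uA by (intro J_sum J_mult_left) auto
  ultimately have "- ((m - (\<Sum>i<n. u i * (v i * m))) + (\<Sum>i<n. u i * (v i * m - x i))) \<in> J"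
    by (intro J_neg J_add)
  also have "- ((m - (\<Sum>i<n. u i * (v i * m))) + (\<Sum>i<n. u i * (v i * m - x i)))
      = (\<Sum>i<n. u i * x i) - m"
    by (simp add: right_diff_distrib sum_subtractf)
  finally show ?thesis .
qed

section \<open>Residue data and finitely many classes\<close>

text \<open>
  With \<open>T\<close> a set of representatives of \<open>\<Lambda>\<close> modulo \<open>c * C\<close>, the residues determine the image of \<open>M\<close> under a frame,
  as it contains \<open>C\<close> times the sum of the modules \<open>e i \<Lambda>\<close>.
\<close>

definition residues :: "'a set \<Rightarrow> int \<Rightarrow> 'a set \<Rightarrow> nat \<Rightarrow> (nat \<Rightarrow> 'a) \<Rightarrow> (nat \<Rightarrow> 'a) \<Rightarrow> 'a list set"
  where "residues M c T n e v =
    {xs. length xs = n \<and> set xs \<subseteq> T \<and> (\<exists>m\<in>M. \<forall>i<n. of_int c *s (v i * m) - e i * xs ! i \<in> J)}"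

text \<open>Lift \<open>C\<close> times \<open>u i * y i\<close> to \<open>M\<close> for each
  \<open>i\<close> and add the lifts. Modulo \<open>J\<close> the products \<open>v j * u i\<close>
  form a diagonal matrix, so only the term \<open>i = j\<close> survives.\<close>

lemma frame_shift:
  assumes fr: "frame M c C n e u v" and M: "zmodule M" and y: "\<forall>i<n. y i \<in> \<Lambda>"
  shows "\<exists>m\<in>M. \<forall>j<n. v j * m - of_int C *s (e j * y j) \<in> J"
proof -
  have "\<forall>i\<in>{..<n}. \<exists>m. m \<in> M \<and> of_int C *s (u i * y i) - m \<in> J"
    using fr y unfolding frame_def by blast
  from bchoice[OF this] obtain g where g: "\<forall>i\<in>{..<n}. g i \<in> M \<and> of_int C *s (u i * y i) - g i \<in> J" ..
  show ?thesis
  proof (intro bexI[of _ "\<Sum>i<n. g i"] allI impI)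
    show "(\<Sum>i<n. g i) \<in> M"
      using g M by (intro zmodule_sum) auto
    fix j assume j: "j < n"
    have vj: "v j \<in> A"
      using fr j by (simp add: frame_def)
    have "v j * g i - of_int C *s ((if j = i then e j else 0) * y i) \<in> J" if i: "i < n" for i
    proof -
      have "of_int C *s ((v j * u i - (if j = i then e j else 0)) * y i) \<in> J"
        using fr i j y in_A by (intro J_scale J_mult_right) (auto simp: frame_def)
      moreover have "v j * (of_int C *s (u i * y i) - g i) \<in> J"
        using g i vj by (intro J_mult_left) auto
      ultimately have "of_int C *s ((v j * u i - (if j = i then e j else 0)) * y i)
          - v j * (of_int C *s (u i * y i) - g i) \<in> J"
        by (rule J_diff)
      then show ?thesis
        by (simp add: left_diff_distrib right_diff_distrib scale_right_diff_distrib scale_mult_right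
            mult.assoc)
    qed
    then have "(\<Sum>i<n. v j * g i - of_int C *s ((if j = i then e j else 0) * y i)) \<in> J"
      by (intro J_sum) auto
    moreover have "(\<Sum>i<n. of_int C *s ((if j = i then e j else 0) * y i)) = of_int C *s (e j * y j)"
    proof -
      have "(\<Sum>i<n. of_int C *s ((if j = i then e j else 0) * y i))
          = (\<Sum>i<n. if j = i then of_int C *s (e j * y i) else 0)"
        by (rule sum.cong) auto
      then show ?thesis
        using j by simp
    qed
    ultimately show "v j * (\<Sum>i<n. g i) - of_int C *s (e j * y j) \<in> J"
      by (simp add: sum_subtractf sum_distrib_left)
  qed
qed

text \<open>Write \<open>c\<close> times the coordinates of \<open>m\<close> as residues plus a part
  divisible by \<open>c * C\<close>. The divisible part is realized by \<open>m1\<close> in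
  \<open>M\<close> and by \<open>m2\<close> in \<open>M'\<close>; the residues belong to
  \<open>m - m1\<close>, and by assumption also to some \<open>m3\<close> in \<open>M'\<close>. Then
  \<open>m3 + m2\<close> has the coordinates of \<open>m\<close>.\<close>

lemma residues_match:
  assumes M: "zmodule M" "zmodule M'" and c: "c > 0"
    and fr: "frame M c C n e u v" "frame M' c C n e' u' v'"
    and e: "\<forall>i<n. e' i = e i"
    and T: "T \<subseteq> \<Lambda>" "\<forall>x\<in>\<Lambda>. \<exists>t\<in>T. \<exists>y\<in>\<Lambda>. x = t + of_int (c * C) *s y"
    and res: "residues M c T n e v \<subseteq> residues M' c T n e' v'"
    and m: "m \<in> M"
  shows "\<exists>m'\<in>M'. \<forall>i<n. v' i * m' - v i * m \<in> J"
proof -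
  have "\<forall>i\<in>{..<n}. \<exists>p. fst p \<in> T \<and> snd p \<in> \<Lambda> \<and>
      of_int c *s (v i * m) - e i * (fst p + of_int (c * C) *s snd p) \<in> J"
  proof
    fix i assume "i \<in> {..<n}"
    then obtain x where x: "x \<in> \<Lambda>" "of_int c *s (v i * m) - e i * x \<in> J"
      using fr(1) m unfolding frame_def near_def by blast
    then obtain t y where "t \<in> T" "y \<in> \<Lambda>" "x = t + of_int (c * C) *s y"
      using T(2) by blast
    then show "\<exists>p. fst p \<in> T \<and> snd p \<in> \<Lambda> \<and>
      of_int c *s (v i * m) - e i * (fst p + of_int (c * C) *s snd p) \<in> J"
      using x(2) by (intro exI[of _ "(t, y)"]) simp
  qed
  from bchoice[OF this] obtain p where p: "\<forall>i\<in>{..<n}. fst (p i) \<in> T \<and> snd (p i) \<in> \<Lambda> \<and>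
      of_int c *s (v i * m) - e i * (fst (p i) + of_int (c * C) *s snd (p i)) \<in> J" ..
  define t y where "t i = fst (p i)" and "y i = snd (p i)" for i
  have t: "\<And>i. i < n \<Longrightarrow> t i \<in> T" and y: "\<forall>i<n. y i \<in> \<Lambda>"
    and ty: "\<And>i. i < n \<Longrightarrow> of_int c *s (v i * m) - e i * (t i + of_int (c * C) *s y i) \<in> J"
    using p by (simp_all add: t_def y_def)
  obtain m1 where m1: "m1 \<in> M" "\<forall>j<n. v j * m1 - of_int C *s (e j * y j) \<in> J"
    using frame_shift[OF fr(1) M(1) y] by blast
  obtain m2 where m2: "m2 \<in> M'" "\<forall>j<n. v' j * m2 - of_int C *s (e' j * y j) \<in> J"
    using frame_shift[OF fr(2) M(2) y] by blast
  have "map t [0..<n] \<in> residues M c T n e v"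
    unfolding residues_def
  proof (intro CollectI conjI bexI[of _ "m - m1"] allI impI)
    fix i assume i: "i < n"
    have "(of_int c *s (v i * m) - e i * (t i + of_int (c * C) *s y i))
        - of_int c *s (v i * m1 - of_int C *s (e i * y i)) \<in> J"
      by (rule J_diff[OF ty[OF i] J_scale[OF m1(2)[rule_format, OF i]]])
    then show "of_int c *s (v i * (m - m1)) - e i * map t [0..<n] ! i \<in> J"
      using i by (simp add: algebra_simps scale_right_diff_distrib scale_mult_right)
  qed (use t m m1(1) M(1) in \<open>auto simp: zmodule_def\<close>)
  then have "map t [0..<n] \<in> residues M' c T n e' v'"
    using res by blast
  then obtain m3 where m3: "m3 \<in> M'" "\<And>i. i < n \<Longrightarrow> of_int c *s (v' i * m3) - e i * t i \<in> J"
    unfolding residues_def using e by auto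
  show ?thesis
  proof (intro bexI[of _ "m3 + m2"] allI impI)
    show "m3 + m2 \<in> M'"
      using m3(1) m2(1) by (rule zmodule_add[OF M(2)])
    fix i assume i: "i < n"
    have "(of_int c *s (v' i * m3) - e i * t i) + of_int c *s (v' i * m2 - of_int C *s (e' i * y i))
        - (of_int c *s (v i * m) - e i * (t i + of_int (c * C) *s y i)) \<in> J"
      by (rule J_diff[OF J_add[OF m3(2)[OF i] J_scale[OF m2(2)[rule_format, OF i]]] ty[OF i]])
    also have "(of_int c *s (v' i * m3) - e i * t i) + of_int c *s (v' i * m2 - of_int C *s (e' i * y i))
        - (of_int c *s (v i * m) - e i * (t i + of_int (c * C) *s y i))
        = of_int c *s (v' i * (m3 + m2) - v i * m)"
      using e i
      by (simp add: algebra_simps scale_right_diff_distrib scale_right_distrib scale_mult_right)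
    finally have "(1 / of_int c) *s (of_int c *s (v' i * (m3 + m2) - v i * m)) \<in> J"
      by (rule J_scale)
    then show "v' i * (m3 + m2) - v i * m \<in> J"
      using c by simp
  qed
qed

text \<open>The maps take coordinates in one frame and reassemble with the other. An element
  \<open>m'\<close> with the coordinates of \<open>m\<close> modulo \<open>J\<close> serves both
  directions.\<close>

lemma frames_equivalent:
  assumes M: "zmodule M" "zmodule M'" and c: "c > 0"
    and fr: "frame M c C n e u v" "frame M' c C n e' u' v'"
    and e: "\<forall>i<n. e' i = e i"
    and T: "T \<subseteq> \<Lambda>" "\<forall>x\<in>\<Lambda>. \<exists>t\<in>T. \<exists>y\<in>\<Lambda>. x = t + of_int (c * C) *s y"
    and res: "residues M c T n e v \<subseteq> residues M' c T n e' v'"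
    and m: "m \<in> M"
  shows "\<exists>m'\<in>M'. (\<Sum>i<n. u' i * v i) * m - m' \<in> J \<and> (\<Sum>i<n. u i * v' i) * m' - m \<in> J"
proof -
  obtain m' where m': "m' \<in> M'" "\<forall>i<n. v' i * m' - v i * m \<in> J"
    using residues_match[OF M c fr e T res m] by (elim bexE)
  have 1: "(\<Sum>i<n. u' i * (v i * m)) - m' \<in> J"
    by (rule frame_apply[OF fr(2) m'(1), of "\<lambda>i. v i * m", OF m'(2)])
  have "\<forall>i<n. v i * m - v' i * m' \<in> J"
  proof (intro allI impI)
    fix i assume "i < n"
    then have "- (v' i * m' - v i * m) \<in> J"
      using m'(2) by (intro J_neg) simp
    then show "v i * m - v' i * m' \<in> J"
      by simp
  qed
  then have 2: "(\<Sum>i<n. u i * (v' i * m')) - m \<in> J"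
    by (rule frame_apply[OF fr(1) m, of "\<lambda>i. v' i * m'"])
  show ?thesis
    using 1 2 by (intro bexI[OF _ m'(1)]) (simp add: sum_distrib_right mult.assoc)
qed

text \<open>The code of \<open>M\<close> consists of the idempotents of a chosen frame and the set
  of its residue tuples. The length is bounded through the dimension of \<open>A\<close> and the
  entries come from the finite sets of \<open>prims\<close> and \<open>T\<close>, so codes are
  finite in number.\<close>

lemma rmod_classes:
  obtains code :: "'a set \<Rightarrow> 'a list \<times> 'a list set" where "finite (code ` {M. rmod M})"
    and "\<And>M M'. rmod M \<Longrightarrow> rmod M' \<Longrightarrow> code M = code M' \<Longrightarrow>
      \<exists>a\<in>A. \<exists>b\<in>A. (\<forall>m\<in>M. \<exists>m'\<in>M'. a * m - m' \<in> J \<and> b * m' - m \<in> J) \<and>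
        (\<forall>m'\<in>M'. \<exists>m\<in>M. b * m' - m \<in> J \<and> a * m - m' \<in> J)"
proof -
  obtain c :: int where c: "c > 0"
    and step: "\<And>M. rmod M \<Longrightarrow> \<not> M \<subseteq> J \<Longrightarrow> \<exists>e\<in>set prims. \<exists>u\<in>M. \<exists>v\<in>A.
      u * e = u \<and> e * v = v \<and> v * u = e \<and> (\<forall>m\<in>M. of_int c *s (v * m) \<in> near e)"
    using step by blast
  define d where "d = Suc (dim A)"
  \<comment> \<open>A multiple of \<open>c ^ n\<close> for every length \<open>n\<close> that
    occurs, so that all frames share \<open>C\<close> and can be compared.\<close>
  define C where "C = c ^ d"
  have ex: "\<exists>n e u v. n \<le> d \<and> frame M c C n e u v" if M: "rmod M" for M
  proof -
    obtain n e u v where n: "n \<le> dim (span (M \<union> J))" and fr: "frame M c (c ^ n) n e u v"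
      using frame_exists[OF c step M] by blast
    have "span (M \<union> J) \<subseteq> A"
      using M J_A by (intro span_minimal subspace_A) (auto simp: rmod_def)
    then have "span (M \<union> J) = A \<or> dim (span (M \<union> J)) < dim A"
      using dim_strict_mono[OF finite_F A_span, of "span (M \<union> J)"] subspace_span by blast
    then have "dim (span (M \<union> J)) \<le> dim A"
      by (elim disjE) (simp only: order_refl, rule less_imp_le)
    then have "n \<le> d"
      using n by (simp add: d_def)
    moreover have "frame M c (c ^ (d - n) * c ^ n) n e u v"
      using fr M by (intro frame_multiple) (auto simp: rmod_def)
    ultimately show ?thesis
      unfolding C_def by (metis le_add_diff_inverse2 power_add)
  qed
  define good where "good M z \<longleftrightarrow> (case z of (n, e, u, v) \<Rightarrow> n \<le> d \<and> frame M c C n e u v)" for M z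
  have "\<forall>M\<in>{M. rmod M}. \<exists>z. good M z"
    using ex unfolding good_def by fast
  from bchoice[OF this] obtain g where g: "\<forall>M\<in>{M. rmod M}. good M (g M)" ..
  have "c * C > 0"
    using c by (simp add: C_def)
  then obtain T where T: "T \<subseteq> \<Lambda>" "finite T"
    "\<forall>x\<in>\<Lambda>. \<exists>t\<in>T. \<exists>y\<in>\<Lambda>. x = t + of_int (c * C) *s y"
    using zspan_residues[OF finite_S, of "c * C"] unfolding \<Lambda>_def by blast
  define code where
    "code M = (case g M of (n, e, u, v) \<Rightarrow> (map e [0..<n], residues M c T n e v))" for M
  show ?thesis
  proof (rule that[of code])
    have "code M \<in> {xs. set xs \<subseteq> set prims \<and> length xs \<le> d} \<times>
        Pow {xs. set xs \<subseteq> T \<and> length xs \<le> d}" if M: "rmod M" for M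
    proof -
      obtain n e u v where gM: "g M = (n, e, u, v)"
        by (cases "g M")
      then have "n \<le> d" "frame M c C n e u v"
        using g M by (auto simp: good_def)
      then show ?thesis
        unfolding code_def gM by (auto simp: frame_def residues_def)
    qed
    then have "code ` {M. rmod M} \<subseteq> {xs. set xs \<subseteq> set prims \<and> length xs \<le> d} \<times>
        Pow {xs. set xs \<subseteq> T \<and> length xs \<le> d}"
      by blast
    moreover have "finite ({xs. set xs \<subseteq> set prims \<and> length xs \<le> d} \<times>
        Pow {xs. set xs \<subseteq> T \<and> length xs \<le> d})"
      using T(2) by (intro finite_cartesian_product finite_Pow_iff[THEN iffD2] finite_lists_length_le)
        auto
    ultimately show "finite (code ` {M. rmod M})"
      by (rule finite_subset)
    fix M M' assume M: "rmod M" and M': "rmod M'" and code: "code M = code M'"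
    obtain n e u v where gM: "g M = (n, e, u, v)"
      by (cases "g M")
    obtain n' e' u' v' where gM': "g M' = (n', e', u', v')"
      by (cases "g M'")
    have maps: "map e [0..<n] = map e' [0..<n']"
      and res: "residues M c T n e v = residues M' c T n' e' v'"
      using code by (simp_all add: code_def gM gM')
    have nn: "n' = n"
      using arg_cong[OF maps, of length] by simp
    have ee: "\<forall>i<n. e' i = e i"
      using maps nn by (simp add: map_eq_conv)
    then have ee': "\<forall>i<n. e i = e' i"
      by simp
    have fr: "frame M c C n e u v" "frame M' c C n e' u' v'"
      using g M M' gM gM' nn by (auto simp: good_def)
    have z: "zmodule M" "zmodule M'"
      using M M' by (auto simp: rmod_def)
    have "(\<Sum>i<n. u' i * v i) \<in> A" "(\<Sum>i<n. u i * v' i) \<in> A"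
      using fr by (auto simp: frame_def intro!: subspace_sum[OF subspace_A] mult_A)
    moreover have "\<forall>m\<in>M. \<exists>m'\<in>M'. (\<Sum>i<n. u' i * v i) * m - m' \<in> J \<and> (\<Sum>i<n. u i * v' i) * m' - m \<in> J"
      using frames_equivalent[OF z c fr ee T(1,3)] res nn by simp
    moreover have "\<forall>m'\<in>M'. \<exists>m\<in>M. (\<Sum>i<n. u i * v' i) * m' - m \<in> J \<and> (\<Sum>i<n. u' i * v i) * m - m' \<in> J"
      using frames_equivalent[OF z(2,1) c fr(2,1) ee' T(1,3)] res nn by simp
    ultimately show "\<exists>a\<in>A. \<exists>b\<in>A. (\<forall>m\<in>M. \<exists>m'\<in>M'. a * m - m' \<in> J \<and> b * m' - m \<in> J) \<and>
        (\<forall>m'\<in>M'. \<exists>m\<in>M. b * m' - m \<in> J \<and> a * m - m' \<in> J)"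
      by blast
  qed
qed

text \<open>Apply the classification to the lattices \<open>e \<Lambda>\<close>. Since
  \<open>1 \<in> \<Lambda>\<close>, the lattice contains \<open>e\<close>, and modulo
  \<open>J\<close> its image under \<open>a\<close> is \<open>f x\<close> with
  \<open>x \<in> \<Lambda>\<close>. Thus \<open>x\<close> and \<open>y\<close> come from
  \<open>\<Lambda>\<close>, whereas \<open>a\<close> and \<open>b\<close> are only known to be in
  \<open>A\<close>.\<close>

lemma idempotent_classes:
  obtains code :: "'a \<Rightarrow> 'a list \<times> 'a list set"
  where "finite (code ` {e \<in> A. e * e = e})"
    and "\<And>e f. e \<in> A \<Longrightarrow> e * e = e \<Longrightarrow> f \<in> A \<Longrightarrow> f * f = f \<Longrightarrow> code e = code f \<Longrightarrow>
      \<exists>x\<in>\<Lambda>. \<exists>y\<in>\<Lambda>. nilp ((e * y * f) * (f * x * e) - e) \<and> nilp ((f * x * e) * (e * y * f) - f)"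
proof -
  obtain code :: "'a set \<Rightarrow> 'a list \<times> 'a list set" where fin: "finite (code ` {M. rmod M})"
    and code: "\<And>M M'. rmod M \<Longrightarrow> rmod M' \<Longrightarrow> code M = code M' \<Longrightarrow>
      \<exists>a\<in>A. \<exists>b\<in>A. (\<forall>m\<in>M. \<exists>m'\<in>M'. a * m - m' \<in> J \<and> b * m' - m \<in> J) \<and>
        (\<forall>m'\<in>M'. \<exists>m\<in>M. b * m' - m \<in> J \<and> a * m - m' \<in> J)"
    using rmod_classes by blast
  define I where "I e = (\<lambda>x. e * x) ` \<Lambda>" for e
  have rmod_I: "rmod (I e)" if e: "e \<in> A" for e
    unfolding rmod_def
  proof (intro conjI ballI)
    show "zmodule (I e)"
      unfolding zmodule_def
    proof (intro conjI ballI)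
      show "0 \<in> I e"
        using zmodule_\<Lambda> by (force simp: I_def zmodule_def)
      fix x y assume "x \<in> I e" "y \<in> I e"
      then show "x - y \<in> I e"
        using zmodule_\<Lambda> by (auto simp: I_def zmodule_def simp flip: right_diff_distrib)
    qed
    show "I e \<subseteq> A"
      using e in_A by (auto simp: I_def closed_A)
    show "m * x \<in> I e" if "m \<in> I e" "x \<in> \<Lambda>" for m x
      using that mult_\<Lambda> by (auto simp: I_def mult.assoc)
    obtain n :: int where "n > 0" "of_int n *s e \<in> \<Lambda>"
      using multiple_\<Lambda>[OF e] by blast
    then show "\<exists>n::int. n > 0 \<and> (\<forall>m\<in>I e. of_int n *s m \<in> \<Lambda>)"
      using mult_\<Lambda> by (intro exI[of _ n]) (auto simp: I_def simp flip: scale_mult_left)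
  qed
  \<comment> \<open>Modulo \<open>J\<close> the product \<open>b * f\<close> may be replaced by
    \<open>e * y\<close>, which eliminates \<open>b\<close>.\<close>
  have half: "nilp ((e * y * f) * (f * x * e) - e)"
    if e: "e \<in> A" "e * e = e" and f: "f \<in> A" "f * f = f" and b: "b \<in> A"
      and x: "x \<in> \<Lambda>" "b * (f * x) - e \<in> J" and y: "y \<in> \<Lambda>" "b * f - e * y \<in> J" for e f b x y
  proof -
    have "(b * (f * x) - e) * e \<in> J" "(b * f - e * y) * (f * x * e) \<in> J"
      using x y e f in_A by (auto intro!: J_mult_right simp: closed_A)
    then have "(b * (f * x) - e) * e - (b * f - e * y) * (f * x * e) \<in> J"
      by (rule J_diff)
    moreover have "(b * (f * x) - e) * e - (b * f - e * y) * (f * x * e)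
        = (e * y * f) * (f * x * e) - e"
    proof -
      have ff: "f * (f * z) = f * z" for z
        using f(2) by (simp flip: mult.assoc)
      show ?thesis
        using e(2) by (simp add: left_diff_distrib mult.assoc ff)
    qed
    ultimately show ?thesis
      using J_nilp by simp
  qed
  show ?thesis
  proof (rule that[of "\<lambda>e. code (I e)"])
    have "(\<lambda>e. code (I e)) ` {e \<in> A. e * e = e} \<subseteq> code ` {M. rmod M}"
      using rmod_I by blast
    then show "finite ((\<lambda>e. code (I e)) ` {e \<in> A. e * e = e})"
      using fin by (rule finite_subset)
    fix e f assume e: "e \<in> A" "e * e = e" and f: "f \<in> A" "f * f = f" and ef: "code (I e) = code (I f)"
    obtain a b where ab: "a \<in> A" "b \<in> A"
      and a: "\<And>m. m \<in> I e \<Longrightarrow> \<exists>m'\<in>I f. a * m - m' \<in> J \<and> b * m' - m \<in> J"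
      and b: "\<And>m'. m' \<in> I f \<Longrightarrow> \<exists>m\<in>I e. b * m' - m \<in> J \<and> a * m - m' \<in> J"
      using code[OF rmod_I[OF e(1)] rmod_I[OF f(1)] ef] by blast
    have "e \<in> I e" "f \<in> I f"
      using one_\<Lambda> by (force simp: I_def)+
    then obtain x y where x: "x \<in> \<Lambda>" "a * e - f * x \<in> J" "b * (f * x) - e \<in> J"
      and y: "y \<in> \<Lambda>" "b * f - e * y \<in> J" "a * (e * y) - f \<in> J"
      using a b unfolding I_def by blast
    show "\<exists>x\<in>\<Lambda>. \<exists>y\<in>\<Lambda>. nilp ((e * y * f) * (f * x * e) - e) \<and> nilp ((f * x * e) * (e * y * f) - f)"
      using half[OF e f ab(2) x(1,3) y(1,2)] half[OF f e ab(1) y(1,3) x(1,2)] x(1) y(1) by blast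
  qed
qed

end

section \<open>Idempotents of a subring\<close>

context rat_algebra
begin

text \<open>Scale a maximal independent subset \<open>Bs\<close> of \<open>E\<close> by a common
  denominator \<open>s\<close> of its structure constants: the product of two scaled elements is
  \<open>s\<close> times an integer combination of \<open>Bs\<close>. Together with 1 they generate
  a subring of \<open>E\<close> with the same rational span.\<close>

lemma order_exists:
  assumes E: "zmodule E" "1 \<in> E" "\<And>x y. x \<in> E \<Longrightarrow> y \<in> E \<Longrightarrow> x * y \<in> E"
    and F: "finite F" "E \<subseteq> span F"
  defines "A \<equiv> {a. \<exists>n::int. n > 0 \<and> of_int n *s a \<in> E}"
  obtains S where "fd_order scale A F S (zspan S)" "zspan S \<subseteq> E"
proof -
  obtain Bs where Bs: "Bs \<subseteq> E" "independent Bs" "E \<subseteq> span Bs"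
    using maximal_independent_subset by blast
  have finBs: "finite Bs"
    using independent_span_bound[OF F(1) Bs(2)] Bs(1) F(2) by blast
  have "\<exists>s::int. s > 0 \<and> (\<forall>p\<in>Bs \<times> Bs. of_int s *s (fst p * snd p) \<in> zspan Bs)"
  proof (rule common_multiple[OF _ _ zmodule_zspan])
    fix p assume "p \<in> Bs \<times> Bs"
    then have "fst p * snd p \<in> E"
      using Bs(1) by (intro E(3)) auto
    then have "fst p * snd p \<in> span Bs"
      using Bs(3) by blast
    then show "\<exists>n::int. n > 0 \<and> of_int n *s (fst p * snd p) \<in> zspan Bs"
      by (rule span_multiple_zspan[OF finBs])
  qed (use finBs in simp)
  then obtain s :: int where s: "s > 0"
    "\<And>b b'. b \<in> Bs \<Longrightarrow> b' \<in> Bs \<Longrightarrow> of_int s *s (b * b') \<in> zspan Bs"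
    by fastforce
  define S where "S = insert 1 ((\<lambda>b. of_int s *s b) ` Bs)"
  have finS: "finite S"
    using finBs by (simp add: S_def)
  have base: "x \<in> zspan S" if "x \<in> S" for x
    using zspan_base[OF finS that] .
  have S_E: "zspan S \<subseteq> E"
    using E Bs(1) by (intro zspan_minimal) (auto simp: S_def intro: zmodule_scale)
  have scaled: "of_int s *s x \<in> zspan S" if x: "x \<in> zspan Bs" for x
  proof -
    have "zmodule {x. of_int s *s x \<in> zspan S}"
      using zmodule_zspan[of S] by (auto simp: zmodule_def scale_right_diff_distrib)
    then have "zspan Bs \<subseteq> {x. of_int s *s x \<in> zspan S}"
      using base by (intro zspan_minimal) (auto simp: S_def)
    then show ?thesis
      using x by blast
  qed
  have gen: "x * y \<in> zspan S" if x: "x \<in> S" and y: "y \<in> S" for x y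
  proof (cases "x = 1 \<or> y = 1")
    case True
    then show ?thesis
      using base[OF x] base[OF y] by auto
  next
    case False
    then obtain b b' where "b \<in> Bs" "b' \<in> Bs" "x = of_int s *s b" "y = of_int s *s b'"
      using x y by (auto simp: S_def)
    then show ?thesis
      using scaled[OF s(2)] by (simp add: scale_mult_left scale_mult_right)
  qed
  have gen1: "x * y \<in> zspan S" if x: "x \<in> S" and y: "y \<in> zspan S" for x y
  proof -
    have "zmodule {y. x * y \<in> zspan S}"
      using zmodule_zspan[of S] by (auto simp: zmodule_def right_diff_distrib)
    then have "zspan S \<subseteq> {y. x * y \<in> zspan S}"
      using gen[OF x] by (intro zspan_minimal) auto
    then show ?thesis
      using y by blast
  qed
  have mult: "x * y \<in> zspan S" if x: "x \<in> zspan S" and y: "y \<in> zspan S" for x y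
  proof -
    have "zmodule {x. x * y \<in> zspan S}"
      using zmodule_zspan[of S] by (auto simp: zmodule_def left_diff_distrib)
    then have "zspan S \<subseteq> {x. x * y \<in> zspan S}"
      using gen1[OF _ y] by (intro zspan_minimal) auto
    then show ?thesis
      using x by blast
  qed
  have E_A: "x \<in> A" if "x \<in> E" for x
    using that unfolding A_def by (intro CollectI exI[of _ 1]) simp
  have A_mult: "x * y \<in> A" if xA: "x \<in> A" and yA: "y \<in> A" for x y
  proof -
    obtain n m :: int where nm: "n > 0" "of_int n *s x \<in> E" "m > 0" "of_int m *s y \<in> E"
      using xA yA unfolding A_def by blast
    then have "of_int (n * m) *s (x * y) \<in> E"
      using E(3)[OF nm(2,4)] by (simp add: scale_mult_left scale_mult_right mult.commute)
    then show ?thesis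
      using nm unfolding A_def by (intro CollectI exI[of _ "n * m"]) simp
  qed
  have A_add: "x + y \<in> A" if xA: "x \<in> A" and yA: "y \<in> A" for x y
  proof -
    obtain n m :: int where nm: "n > 0" "of_int n *s x \<in> E" "m > 0" "of_int m *s y \<in> E"
      using xA yA unfolding A_def by blast
    have "of_int m *s (of_int n *s x) + of_int n *s (of_int m *s y) \<in> E"
      by (rule zmodule_add[OF E(1) zmodule_scale[OF E(1) nm(2)] zmodule_scale[OF E(1) nm(4)]])
    then have "of_int (n * m) *s (x + y) \<in> E"
      by (simp add: scale_right_distrib mult.commute)
    then show ?thesis
      using nm unfolding A_def by (intro CollectI exI[of _ "n * m"]) simp
  qed
  have A_scale: "q *s x \<in> A" if xA: "x \<in> A" for q x
  proof -
    obtain n :: int where n: "n > 0" "of_int n *s x \<in> E"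
      using xA unfolding A_def by blast
    obtain k m :: int where k: "k > 0" "of_int k * q = of_int m"
      using rat_multiple_int by blast
    have "of_int (n * k) * q = of_int m * of_int n"
      using k(2) by (simp add: mult.assoc mult.commute)
    then have "of_int (n * k) *s (q *s x) = of_int m *s (of_int n *s x)"
      by (simp only: scale_scale)
    then have "of_int (n * k) *s (q *s x) \<in> E"
      using zmodule_scale[OF E(1) n(2), of m] by metis
    then show ?thesis
      using n k unfolding A_def by (intro CollectI exI[of _ "n * k"]) simp
  qed
  have A_mult_S: "\<exists>n::int. n > 0 \<and> of_int n *s x \<in> zspan S" if xA: "x \<in> A" for x
  proof -
    obtain n :: int where n: "n > 0" "of_int n *s x \<in> E"
      using xA unfolding A_def by blast
    then obtain m :: int where m: "m > 0" "of_int m *s (of_int n *s x) \<in> zspan Bs"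
      using span_multiple_zspan[OF finBs] Bs(3) by blast
    show ?thesis
      using scaled[OF m(2)] n m s(1) by (intro exI[of _ "s * (m * n)"]) simp
  qed
  have A_F: "A \<subseteq> span F"
  proof
    fix x assume "x \<in> A"
    then obtain n :: int where n: "n > 0" "of_int n *s x \<in> E"
      unfolding A_def by blast
    then have "(1 / of_int n) *s (of_int n *s x) \<in> span F"
      using F(2) span_scale by blast
    then show "x \<in> span F"
      using n(1) by simp
  qed
  have "subspace A"
    by (rule subspaceI) (use A_add A_scale E_A E(1) in \<open>auto simp: zmodule_def\<close>)
  then have "fd_order scale A F S (zspan S)"
    by unfold_locales
      (use A_mult A_F A_mult_S E_A E(2) F(1) S_E finS mult base in \<open>auto simp: S_def\<close>)
  then show ?thesis
    using that S_E by blast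
qed

text \<open>Nilpotent errors can be removed inside \<open>E\<close>, without denominators: the
  inverse of \<open>b * a\<close> in the corner of \<open>e\<close> is a geometric series, and
  correcting \<open>b\<close> by it makes the product exactly \<open>e\<close>.\<close>

lemma idempotents_equivalent:
  assumes E: "zmodule E" "1 \<in> E" "\<And>x y. x \<in> E \<Longrightarrow> y \<in> E \<Longrightarrow> x * y \<in> E"
    and e: "e \<in> E" "e * e = e" and f: "f \<in> E" "f * f = f" and xy: "x \<in> E" "y \<in> E"
    and nilp: "nilp ((e * y * f) * (f * x * e) - e)" "nilp ((f * x * e) * (e * y * f) - f)"
  shows "\<exists>a\<in>E. \<exists>b\<in>E. f * a = a \<and> e * b = b \<and> b * a = e \<and> a * b = f"
proof -
  have inverse: "\<exists>w\<in>E. (b * a) * w = e \<and> w * (b * a) = e"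
    if e: "e \<in> E" "e * e = e" and ba: "b * a \<in> E" "e * (b * a) = b * a" "(b * a) * e = b * a"
      and n: "nilp (b * a - e)" for e a b
  proof -
    define z where "z = e - b * a"
    have "z = - (b * a - e)"
      by (simp add: z_def)
    then obtain n where zn: "z ^ n = 0"
      using nilp_scale[OF n, of "-1"] unfolding nilp_def by auto
    have z: "e * z = z" "z * e = z" "z \<in> E"
      using e ba E(1) by (auto simp: z_def algebra_simps zmodule_def)
    have "z ^ i \<in> E" for i
      using E(2,3) z(3) by (induction i) auto
    then have "e * (\<Sum>i<n. z ^ i) \<in> E"
      using E(1,3) e(1) by (simp add: zmodule_sum)
    moreover have "e - z = b * a"
      by (simp add: z_def)
    ultimately show ?thesis
      using geometric_inverse_corner[OF z(1,2) e(2) zn] by auto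
  qed
  define a where "a = f * x * e"
  define b where "b = e * y * f"
  have E': "a \<in> E" "b \<in> E"
    using e f xy E(3) by (simp_all add: a_def b_def)
  have ab: "f * a = a" "a * e = a" "e * b = b" "b * f = b"
    using e(2) f(2) by (simp_all add: a_def b_def mult.assoc) (simp_all flip: mult.assoc)
  obtain w where w: "w \<in> E" "w * (b * a) = e"
  proof -
    have "b * a \<in> E" "e * (b * a) = b * a" "(b * a) * e = b * a"
      using E' E(3) ab by (simp, simp flip: mult.assoc, simp add: mult.assoc)
    then show ?thesis
      using inverse[OF e _ _ _ nilp(1)[folded a_def b_def]] that by blast
  qed
  obtain w' where w': "w' \<in> E" "(a * b) * w' = f"
  proof -
    have "a * b \<in> E" "f * (a * b) = a * b" "(a * b) * f = a * b"
      using E' E(3) ab by (simp, simp flip: mult.assoc, simp add: mult.assoc)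
    then show ?thesis
      using inverse[OF f _ _ _ nilp(2)[folded a_def b_def]] that by blast
  qed
  show ?thesis
  proof (intro bexI conjI)
    show "f * a = a" "a \<in> E" "e * (e * (w * b)) = e * (w * b)" "e * (w * b) \<in> E"
      using ab E' E(3) e w by (simp_all flip: mult.assoc)
    have 1: "(e * (w * b)) * a = e"
      using w(2) e(2) by (simp add: mult.assoc)
    then show "(e * (w * b)) * a = e" .
    \<comment> \<open>The left inverse of \<open>a\<close> coincides with its right inverse
      \<open>b * w'\<close>, so the product in the other order is \<open>f\<close>.\<close>
    have "e * (w * b) = (e * (w * b)) * ((a * b) * w')"
      using w'(2) ab(4) by (simp add: mult.assoc)
    also have "\<dots> = ((e * (w * b)) * a) * (b * w')"
      by (simp only: mult.assoc)
    also have "\<dots> = b * w'"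
      using 1 ab(3) by (simp flip: mult.assoc)
    finally show "a * (e * (w * b)) = f"
      using w'(2) by (simp add: mult.assoc)
  qed
qed

lemma subring_idempotent_classes:
  assumes E: "zmodule E" "1 \<in> E" "\<And>x y. x \<in> E \<Longrightarrow> y \<in> E \<Longrightarrow> x * y \<in> E"
    and F: "finite F" "E \<subseteq> span F"
  obtains code :: "'a \<Rightarrow> 'a list \<times> 'a list set" where "finite (code ` {e \<in> E. e * e = e})"
    and "\<And>e f. e \<in> E \<Longrightarrow> e * e = e \<Longrightarrow> f \<in> E \<Longrightarrow> f * f = f \<Longrightarrow> code e = code f \<Longrightarrow>
      \<exists>a\<in>E. \<exists>b\<in>E. f * a = a \<and> e * b = b \<and> b * a = e \<and> a * b = f"
proof -
  define A where "A = {a. \<exists>n::int. n > 0 \<and> of_int n *s a \<in> E}"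
  obtain S where S: "fd_order scale A F S (zspan S)" "zspan S \<subseteq> E"
    using order_exists[OF E F] unfolding A_def by blast
  interpret fd_order scale A F S "zspan S"
    by (rule S(1))
  have E_A: "x \<in> A" if "x \<in> E" for x
    using that unfolding A_def by (intro CollectI exI[of _ 1]) simp
  obtain code :: "'a \<Rightarrow> 'a list \<times> 'a list set" where fin: "finite (code ` {e \<in> A. e * e = e})"
    and code: "\<And>e f. e \<in> A \<Longrightarrow> e * e = e \<Longrightarrow> f \<in> A \<Longrightarrow> f * f = f \<Longrightarrow> code e = code f \<Longrightarrow>
      \<exists>x\<in>zspan S. \<exists>y\<in>zspan S. nilp ((e * y * f) * (f * x * e) - e) \<and> nilp ((f * x * e) * (e * y * f) - f)"
    using idempotent_classes by blast
  show ?thesis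
  proof (rule that[of code])
    show "finite (code ` {e \<in> E. e * e = e})"
      using fin by (rule finite_subset[rotated]) (use E_A in blast)
    fix e f assume ef: "e \<in> E" "e * e = e" "f \<in> E" "f * f = f" "code e = code f"
    then obtain x y where xy: "x \<in> zspan S" "y \<in> zspan S"
      "nilp ((e * y * f) * (f * x * e) - e)" "nilp ((f * x * e) * (e * y * f) - f)"
      using code[OF E_A ef(2) E_A ef(4,5)] by blast
    then show "\<exists>a\<in>E. \<exists>b\<in>E. f * a = a \<and> e * b = b \<and> b * a = e \<and> a * b = f"
      using idempotents_equivalent[OF E ef(1-4) _ _ xy(3,4)] S(2) by blast
  qed
qed

end

section \<open>Endomorphisms of a finite rank group\<close>

text \<open>Additive maps form a type so that the ring class applies. The sort
  \<open>zero_neq_one\<close> supplies a nonzero vector, which separates the maps 0 and 1.\<close>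

typedef (overloaded) 'v endo =
    "{f :: 'v::{ab_group_add,zero_neq_one} \<Rightarrow> 'v. \<forall>x y. f (x + y) = f x + f y}"
  morphisms app Endo
  by (rule exI[of _ "\<lambda>x. x"]) simp

lemma endo_eqI: "(\<And>x. app a x = app b x) \<Longrightarrow> a = b"
  by (rule app_inject[THEN iffD1], rule ext)

lemma app_add: "app a (x + y) = app a x + app a y"
  using app[of a] by simp

lemma app_zero: "app a 0 = 0"
  using app_add[of a 0 0] by simp

lemma app_diff: "app a (x - y) = app a x - app a y"
  using app_add[of a "x - y" y] by simp

setup_lifting type_definition_endo

instantiation endo :: ("{ab_group_add,zero_neq_one}") ring_1
begin

lift_definition zero_endo :: "'a endo" is "\<lambda>_. 0" by simp
lift_definition one_endo :: "'a endo" is "\<lambda>x. x" by simp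
lift_definition plus_endo :: "'a endo \<Rightarrow> 'a endo \<Rightarrow> 'a endo" is "\<lambda>f g x. f x + g x"
  by (simp add: algebra_simps)
lift_definition uminus_endo :: "'a endo \<Rightarrow> 'a endo" is "\<lambda>f x. - f x"
  by simp
lift_definition minus_endo :: "'a endo \<Rightarrow> 'a endo \<Rightarrow> 'a endo" is "\<lambda>f g x. f x - g x"
  by (simp add: algebra_simps)
lift_definition times_endo :: "'a endo \<Rightarrow> 'a endo \<Rightarrow> 'a endo" is "\<lambda>f g x. f (g x)"
  by simp

lemmas app_simps = zero_endo.rep_eq one_endo.rep_eq plus_endo.rep_eq uminus_endo.rep_eq
  minus_endo.rep_eq times_endo.rep_eq

instance
proof
  fix a b c :: "'a endo"
  show "a * b * c = a * (b * c)" "1 * a = a" "a * 1 = a" "a + b + c = a + (b + c)" "a + b = b + a"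
    "0 + a = a" "- a + a = 0" "a - b = a + - b" "(a + b) * c = a * c + b * c"
    "a * (b + c) = a * b + a * c"
    by (rule endo_eqI, simp add: app_simps app_add add_ac)+
  have "app 0 1 \<noteq> app (1 :: 'a endo) 1"
    by (simp add: app_simps)
  then show "(0 :: 'a endo) \<noteq> 1"
    by metis
qed

end

lemma app_sum_endo: "app (sum f I) x = (\<Sum>i\<in>I. app (f i) x)"
  by (induction I rule: infinite_finite_induct) (simp_all add: app_simps)

locale endo_space = rat_vector_space scale
  for scale :: "rat \<Rightarrow> 'v::{ab_group_add,zero_neq_one} \<Rightarrow> 'v" (infixr "*s" 75)
begin

text \<open>Additive maps of rational vector spaces are linear: integer multiples come from
  additivity, and a positive denominator can be cancelled.\<close>

lemma app_scale: "app a (q *s x) = q *s app a x"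
proof -
  have nat: "app a (of_nat n *s x) = of_nat n *s app a x" for n x
    by (induction n) (simp_all add: app_zero app_add scale_left_distrib)
  have int: "app a (of_int m *s x) = of_int m *s app a x" for m x
  proof (cases m)
    case (nonneg n)
    then show ?thesis using nat[of n] by simp
  next
    case (neg n)
    have "app a (- (of_nat (Suc n) *s x)) = - (of_nat (Suc n) *s app a x)"
      using app_diff[of a 0] nat[of "Suc n" x] by (simp only: app_zero diff_0)
    moreover have "of_int m = - (of_nat (Suc n) :: rat)"
      by (simp add: neg)
    ultimately show ?thesis
      by (simp only: scale_minus_left)
  qed
  obtain n m :: int where n: "n > 0" "of_int n * q = of_int m"
    using rat_multiple_int by blast
  have "of_int n *s app a (q *s x) = app a ((of_int n * q) *s x)"
    using int[of n "q *s x"] by simp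
  also have "\<dots> = of_int n *s (q *s app a x)"
    unfolding n(2) int by (simp flip: n(2))
  finally show ?thesis
    by (rule scale_left_imp_eq[rotated]) (use n(1) in simp)
qed

definition escale :: "rat \<Rightarrow> 'v endo \<Rightarrow> 'v endo"
  where "escale q a = Endo (\<lambda>x. q *s app a x)"

lemma app_escale: "app (escale q a) x = q *s app a x"
  unfolding escale_def by (subst Endo_inverse) (simp_all add: app_add scale_right_distrib)

sublocale endo: rat_algebra escale
proof
  fix q r :: rat and a b :: "'v endo"
  show "escale q (a + b) = escale q a + escale q b"
    by (rule endo_eqI) (simp add: app_simps app_escale scale_right_distrib)
  show "escale (q + r) a = escale q a + escale r a"
    by (rule endo_eqI) (simp add: app_simps app_escale scale_left_distrib)
  show "escale q (escale r a) = escale (q * r) a"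
    by (rule endo_eqI) (simp add: app_escale)
  show "escale 1 a = a"
    by (rule endo_eqI) (simp add: app_escale)
  show "escale q a * b = escale q (a * b)"
    by (rule endo_eqI) (simp add: app_simps app_escale)
  show "a * escale q b = escale q (a * b)"
    by (rule endo_eqI) (simp add: app_simps app_escale app_scale)
qed

lemma linear_app: "Vector_Spaces.linear scale scale (app a)"
  by unfold_locales (rule app_add app_scale)+

lemma endo_of_basis:
  assumes "independent B"
  obtains a where "\<And>b. b \<in> B \<Longrightarrow> app a b = f b" "\<And>x. app a x \<in> span (f ` B)"
proof -
  interpret pair: vector_space_pair scale scale
    by unfold_locales
  let ?g = "pair.construct B f"
  interpret lin: Vector_Spaces.linear scale scale ?g
    by (rule pair.linear_construct[OF assms])
  have "app (Endo ?g) = ?g"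
    by (intro Endo_inverse CollectI allI lin.add)
  then show ?thesis
    using that[of "Endo ?g"] pair.construct_basis[OF assms] pair.construct_in_span[OF assms] by simp
qed

end

text \<open>\<open>P\<close> is a linear projection of the ambient space, possibly
  infinite-dimensional, onto the span of \<open>G\<close>. It separates the part seen by
  \<open>G\<close> from a complement on which endomorphisms have to be normalized.\<close>

locale finite_rank_group = endo_space scale
  for scale :: "rat \<Rightarrow> 'v::{ab_group_add,zero_neq_one} \<Rightarrow> 'v" (infixr "*s" 75) +
  fixes G B :: "'v set" and P :: "'v endo"
  assumes G: "zmodule G" and finite_B: "finite B" and B_G: "B \<subseteq> G"
    and independent_B: "independent B" and G_span: "G \<subseteq> span B"
    and P_basis: "\<And>b. b \<in> B \<Longrightarrow> app P b = b" and P_span: "\<And>x. app P x \<in> span B"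
begin

text \<open>The scalar \<open>q\<close> on the kernel of \<open>P\<close> makes \<open>E\<close> a ring with unit \<open>1\<close> while keeping its rank finite.\<close>

definition E :: "'v endo set"
  where "E = {a. (\<forall>g\<in>G. app a g \<in> G) \<and> (\<exists>q. \<forall>x. app a (x - app P x) = q *s (x - app P x))}"

lemma eq_on_span:
  assumes "\<And>b. b \<in> B \<Longrightarrow> app a b = app a' b" "x \<in> span B"
  shows "app a x = app a' x"
proof -
  interpret pair: vector_space_pair scale scale
    by unfold_locales
  show ?thesis
    by (rule pair.linear_eq_on[OF linear_app linear_app assms(2)]) (rule assms(1))
qed

lemma P_on_span: "x \<in> span B \<Longrightarrow> app P x = x"
  using eq_on_span[of P 1 x] P_basis by (simp add: app_simps)

lemma zmodule_E: "endo.zmodule E"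
  unfolding endo.zmodule_def
proof (intro conjI ballI)
  show "0 \<in> E"
    using G by (auto simp: E_def app_simps zmodule_def intro: exI[of _ 0])
  fix a b assume a: "a \<in> E" and b: "b \<in> E"
  obtain q where "\<forall>x. app a (x - app P x) = q *s (x - app P x)"
    using a by (auto simp: E_def)
  moreover obtain r where "\<forall>x. app b (x - app P x) = r *s (x - app P x)"
    using b by (auto simp: E_def)
  ultimately have "\<forall>x. app (a - b) (x - app P x) = (q - r) *s (x - app P x)"
    by (simp add: app_simps scale_left_diff_distrib)
  then show "a - b \<in> E"
    using a b G by (auto simp: E_def app_simps zmodule_def)
qed

lemma one_E: "1 \<in> E"
  by (auto simp: E_def app_simps intro: exI[of _ 1])

lemma mult_E:
  assumes a: "a \<in> E" and b: "b \<in> E"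
  shows "a * b \<in> E"
proof -
  obtain q where "\<forall>x. app a (x - app P x) = q *s (x - app P x)"
    using a by (auto simp: E_def)
  moreover obtain r where "\<forall>x. app b (x - app P x) = r *s (x - app P x)"
    using b by (auto simp: E_def)
  ultimately have "\<forall>x. app (a * b) (x - app P x) = r *s (q *s (x - app P x))"
    by (simp only: app_simps app_scale) simp
  then have "\<forall>x. app (a * b) (x - app P x) = (r * q) *s (x - app P x)"
    by (simp add: mult.assoc)
  then show ?thesis
    using a b by (auto simp: E_def app_simps)
qed

text \<open>Matrix units for \<open>B\<close>, cut off by \<open>P\<close>, span together with
  \<open>1 - P\<close>: an element of \<open>E\<close> is determined by its values on
  \<open>B\<close> and its scalar on the kernel of \<open>P\<close>.\<close>

lemma E_finite_dimensional:
  obtains F where "finite F" "E \<subseteq> endo.span F"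
proof -
  have "\<forall>p\<in>B \<times> B. \<exists>a. \<forall>b\<in>B. app a b = (if b = fst p then snd p else 0)"
  proof
    fix p assume "p \<in> B \<times> B"
    obtain a where "\<And>b. b \<in> B \<Longrightarrow> app a b = (if b = fst p then snd p else 0)"
      using endo_of_basis[OF independent_B, of "\<lambda>b. if b = fst p then snd p else 0"] by blast
    then show "\<exists>a. \<forall>b\<in>B. app a b = (if b = fst p then snd p else 0)"
      by blast
  qed
  from bchoice[OF this] obtain u
    where u: "\<forall>p\<in>B \<times> B. \<forall>b\<in>B. app (u p) b = (if b = fst p then snd p else 0)" ..
  define F where "F = insert (1 - P) ((\<lambda>p. u p * P) ` (B \<times> B))"
  have "a \<in> endo.span F" if a: "a \<in> E" for a
  proof -
    obtain q where q: "\<And>x. app a (x - app P x) = q *s (x - app P x)"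
      using a by (auto simp: E_def)
    define c where "c p = representation B (app a (fst p)) (snd p)" for p
    define a' where "a' = (\<Sum>p\<in>B \<times> B. escale (c p) (u p))"
    have "app a' b = app a b" if b: "b \<in> B" for b
    proof -
      have "app a' b = (\<Sum>p\<in>B \<times> B. c p *s app (u p) b)"
        by (simp add: a'_def app_sum_endo app_escale)
      also have "\<dots> = (\<Sum>p\<in>B \<times> B. if b = fst p then c p *s snd p else 0)"
      proof (rule sum.cong[OF refl])
        fix p assume "p \<in> B \<times> B"
        then have "app (u p) b = (if b = fst p then snd p else 0)"
          using u b by blast
        then show "c p *s app (u p) b = (if b = fst p then c p *s snd p else 0)"
          by simp
      qed
      also have "\<dots> = (\<Sum>x\<in>B. \<Sum>y\<in>B. if b = x then c (x, y) *s y else 0)"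
        by (simp only: sum.cartesian_product' fst_conv snd_conv)
      also have "\<dots> = (\<Sum>x\<in>B. if b = x then \<Sum>y\<in>B. c (x, y) *s y else 0)"
        by (intro sum.cong) auto
      also have "\<dots> = (\<Sum>y\<in>B. c (b, y) *s y)"
        using b finite_B by simp
      also have "\<dots> = app a b"
      proof -
        have "app a b \<in> span B"
          using a b B_G G_span by (auto simp: E_def)
        then show ?thesis
          using sum_representation_eq[OF independent_B _ finite_B subset_refl]
          by (simp add: c_def)
      qed
      finally show ?thesis .
    qed
    then have on_P: "app a' (app P x) = app a (app P x)" for x
      using eq_on_span[OF _ P_span] by blast
    have "a = a' * P + escale q (1 - P)"
    proof (rule endo_eqI)
      fix x
      have "app a x = app a (app P x) + app a (x - app P x)"
        by (simp flip: app_add)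
      also have "\<dots> = app a' (app P x) + q *s (x - app P x)"
        by (simp only: on_P q)
      finally show "app a x = app (a' * P + escale q (1 - P)) x"
        by (simp only: app_simps app_escale)
    qed
    also have "a' * P = (\<Sum>p\<in>B \<times> B. escale (c p) (u p * P))"
      by (simp add: a'_def sum_distrib_right endo.scale_mult_left)
    also have "(\<Sum>p\<in>B \<times> B. escale (c p) (u p * P)) + escale q (1 - P) \<in> endo.span F"
      by (intro endo.span_add endo.span_sum endo.span_scale endo.span_base) (auto simp: F_def)
    finally show ?thesis .
  qed
  moreover have "finite F"
    using finite_B by (simp add: F_def)
  ultimately show ?thesis
    using that by blast
qed

text \<open>The projection onto \<open>H\<close> is prescribed on \<open>B\<close> and extended
  linearly. By additivity it respects the splitting on \<open>zspan B\<close>, and then on all of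
  \<open>G\<close>, because a multiple of each element lies in \<open>zspan B\<close> and
  \<open>H \<inter> K = {0}\<close> makes components unique.\<close>

lemma summand_projection:
  assumes H: "H \<subseteq> G" "zmodule H" "zmodule K" "H \<inter> K = {0}"
    and HK: "\<forall>g\<in>G. \<exists>h\<in>H. \<exists>k\<in>K. g = h + k"
  shows "\<exists>e\<in>E. e * e = e \<and> (\<forall>g\<in>G. app e g \<in> H) \<and> (\<forall>h\<in>H. app e h = h)"
proof -
  have "\<forall>b\<in>B. \<exists>h. h \<in> H \<and> b - h \<in> K"
    using HK B_G by fastforce
  from bchoice[OF this] obtain f where f: "\<forall>b\<in>B. f b \<in> H \<and> b - f b \<in> K" ..
  obtain c where c: "\<And>b. b \<in> B \<Longrightarrow> app c b = f b"
    using endo_of_basis[OF independent_B, of f] by blast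
  \<comment> \<open>Composing with \<open>P\<close> makes the map vanish on the kernel of
    \<open>P\<close>, so that it acts there as the scalar 0 and can belong to
    \<open>E\<close>.\<close>
  define e where "e = c * P"
  have e_span: "app e x = app c x" if "x \<in> span B" for x
    using P_on_span[OF that] by (simp add: e_def app_simps)
  have zspan: "app c x \<in> H \<and> x - app c x \<in> K" if x: "x \<in> zspan B" for x
  proof -
    have "zmodule {x. app c x \<in> H \<and> x - app c x \<in> K}"
      unfolding zmodule_def
    proof (intro conjI ballI; clarsimp)
      show "app c 0 \<in> H \<and> - app c 0 \<in> K"
        using H by (simp add: app_zero zmodule_def)
      fix x y assume xy: "app c x \<in> H" "x - app c x \<in> K" "app c y \<in> H" "y - app c y \<in> K"
      then have "app c x - app c y \<in> H" "(x - app c x) - (y - app c y) \<in> K"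
        using H by (auto simp: zmodule_def)
      then show "app c (x - y) \<in> H \<and> x - y - app c (x - y) \<in> K"
        by (simp add: app_diff algebra_simps)
    qed
    then have "zspan B \<subseteq> {x. app c x \<in> H \<and> x - app c x \<in> K}"
      using f c by (intro zspan_minimal) auto
    then show ?thesis
      using x by blast
  qed
  have split: "app e (h + k) = h" if hk: "h \<in> H" "k \<in> K" "h + k \<in> G" for h k
  proof -
    have hkB: "h + k \<in> span B"
      using hk(3) G_span by blast
    then obtain n :: int where n: "n > 0" "of_int n *s (h + k) \<in> zspan B"
      using span_multiple_zspan[OF finite_B] by blast
    define x where "x = of_int n *s (h + k)"
    have "of_int n *s h - app c x \<in> H"
      using zspan[OF n(2)] zmodule_scale[OF H(2) hk(1), of n] H(2)
      by (auto simp: x_def zmodule_def)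
    moreover have "(x - app c x) - of_int n *s k \<in> K"
      using zspan[OF n(2)] zmodule_scale[OF H(3) hk(2), of n] H(3)
      by (auto simp: x_def zmodule_def)
    moreover have "(x - app c x) - of_int n *s k = of_int n *s h - app c x"
      by (simp add: x_def scale_right_distrib)
    ultimately have "of_int n *s h - app c x \<in> H \<inter> K"
      by (simp only: Int_iff)
    then have "of_int n *s app c (h + k) = of_int n *s h"
      unfolding H(4) x_def by (simp only: app_scale singleton_iff right_minus_eq)
    then have "app c (h + k) = h"
      using n(1) by simp
    then show ?thesis
      using e_span[OF hkB] by simp
  qed
  have eG: "app e g \<in> H" if "g \<in> G" for g
    using HK split that by fastforce
  have eH: "app e h = h" if "h \<in> H" for h
    using split[of h 0] that H by (auto simp: zmodule_def)
  have "app e (app e b) = app e b" if "b \<in> B" for b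
    using eH[OF eG] that B_G by auto
  then have "app e (app e (app P x)) = app e (app P x)" for x
    using eq_on_span[of "e * e" e "app P x"] P_span by (simp add: app_simps)
  moreover have eP: "app e (app P x) = app e x" for x
    using P_on_span[OF P_span] by (simp add: e_def app_simps)
  ultimately have "e * e = e"
    by (intro endo_eqI) (simp add: app_simps)
  moreover have "app e (x - app P x) = 0 *s (x - app P x)" for x
    using eP[of x] by (simp add: app_diff)
  then have "e \<in> E"
    using eG H(1) unfolding E_def by blast
  ultimately show ?thesis
    using eG eH by blast
qed

definition splits :: "'v set \<Rightarrow> bool"
  where "splits H \<longleftrightarrow> H \<subseteq> G \<and> zmodule H \<and>
    (\<exists>K. zmodule K \<and> H \<inter> K = {0} \<and> (\<forall>g\<in>G. \<exists>h\<in>H. \<exists>k\<in>K. g = h + k))"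

text \<open>The code of \<open>H\<close> is that of a chosen projection onto it. Elements
  \<open>a\<close> and \<open>b\<close> linking two projections restrict to mutually inverse maps of
  the summands.\<close>

lemma splitting_classes:
  obtains code :: "'v set \<Rightarrow> 'v endo list \<times> 'v endo list set"
  where "finite (code ` {H. splits H})"
    and "\<And>H K. splits H \<Longrightarrow> splits K \<Longrightarrow> code H = code K \<Longrightarrow> \<exists>a. bij_betw (app a) H K"
proof -
  obtain F where F: "finite F" "E \<subseteq> endo.span F"
    using E_finite_dimensional by blast
  obtain code :: "'v endo \<Rightarrow> 'v endo list \<times> 'v endo list set"
    where fin: "finite (code ` {e \<in> E. e * e = e})"
    and code: "\<And>e f. e \<in> E \<Longrightarrow> e * e = e \<Longrightarrow> f \<in> E \<Longrightarrow> f * f = f \<Longrightarrow> code e = code f \<Longrightarrow>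
      \<exists>a\<in>E. \<exists>b\<in>E. f * a = a \<and> e * b = b \<and> b * a = e \<and> a * b = f"
    using endo.subring_idempotent_classes[OF zmodule_E one_E mult_E F] by blast
  have "\<forall>H\<in>{H. splits H}. \<exists>e. e \<in> E \<and> e * e = e \<and> (\<forall>g\<in>G. app e g \<in> H) \<and> (\<forall>h\<in>H. app e h = h)"
  proof
    fix H assume "H \<in> {H. splits H}"
    then obtain K where "H \<subseteq> G" "zmodule H" "zmodule K" "H \<inter> K = {0}"
      "\<forall>g\<in>G. \<exists>h\<in>H. \<exists>k\<in>K. g = h + k"
      unfolding splits_def by (elim CollectE conjE exE)
    from summand_projection[OF this]
    show "\<exists>e. e \<in> E \<and> e * e = e \<and> (\<forall>g\<in>G. app e g \<in> H) \<and> (\<forall>h\<in>H. app e h = h)"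
      by blast
  qed
  from bchoice[OF this] obtain \<pi> where \<pi>: "\<forall>H\<in>{H. splits H}. \<pi> H \<in> E \<and> \<pi> H * \<pi> H = \<pi> H \<and>
      (\<forall>g\<in>G. app (\<pi> H) g \<in> H) \<and> (\<forall>h\<in>H. app (\<pi> H) h = h)" ..
  then have \<pi>E: "splits H \<Longrightarrow> \<pi> H \<in> E" and \<pi>\<pi>: "splits H \<Longrightarrow> \<pi> H * \<pi> H = \<pi> H"
    and \<pi>G: "splits H \<Longrightarrow> g \<in> G \<Longrightarrow> app (\<pi> H) g \<in> H"
    and \<pi>H: "splits H \<Longrightarrow> h \<in> H \<Longrightarrow> app (\<pi> H) h = h" for H g h
    by blast+
  have into: "app a h \<in> K" if "splits H" "splits K" "a \<in> E" "\<pi> K * a = a" "h \<in> H" for a h H K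
  proof -
    have "app a h \<in> G"
      using that(1,3,5) unfolding E_def splits_def by blast
    then have "app (\<pi> K) (app a h) \<in> K"
      by (rule \<pi>G[OF that(2)])
    then have "app (\<pi> K * a) h \<in> K"
      by (simp only: times_endo.rep_eq)
    then show ?thesis
      by (simp only: that(4))
  qed
  have cancel: "app b (app a h) = h" if "splits H" "b * a = \<pi> H" "h \<in> H" for a b h H
    using \<pi>H[OF that(1,3)] unfolding that(2)[symmetric] times_endo.rep_eq .
  show ?thesis
  proof (rule that[of "\<lambda>H. code (\<pi> H)"])
    show "finite ((\<lambda>H. code (\<pi> H)) ` {H. splits H})"
      using fin by (rule finite_subset[rotated]) (use \<pi>E \<pi>\<pi> in blast)
    fix H K assume HK: "splits H" "splits K" "code (\<pi> H) = code (\<pi> K)"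
    obtain a b where ab: "a \<in> E" "b \<in> E" "\<pi> K * a = a" "\<pi> H * b = b" "b * a = \<pi> H" "a * b = \<pi> K"
      using code[OF \<pi>E[OF HK(1)] \<pi>\<pi>[OF HK(1)] \<pi>E[OF HK(2)] \<pi>\<pi>[OF HK(2)] HK(3)] by blast
    have "bij_betw (app a) H K"
    proof (rule bij_betw_byWitness[where f' = "app b"])
      show "\<forall>h\<in>H. app b (app a h) = h"
        using cancel[OF HK(1) ab(5)] by blast
      show "\<forall>k\<in>K. app a (app b k) = k"
        using cancel[OF HK(2) ab(6)] by blast
      show "app a ` H \<subseteq> K"
        using into[OF HK(1,2) ab(1,3)] by blast
      show "app b ` K \<subseteq> H"
        using into[OF HK(2,1) ab(2,4)] by blast
    qed
    then show "\<exists>a. bij_betw (app a) H K" ..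
  qed
qed

end

section \<open>Subgroups of the sequence space\<close>

interpretation sequences: endo_space "\<lambda>(q::rat) (x::nat \<Rightarrow> rat) n. q * x n"
  by unfold_locales

lemma subgroup_zmodule:
  assumes G: "subgroup G rat_seq_group" and H: "subgroup H (rat_seq_group\<lparr>carrier := G\<rparr>)"
  shows "H \<subseteq> G" and "sequences.zmodule H"
proof -
  have comm: "comm_group rat_seq_group"
    by (rule comm_group_rat_seq_group)
  have grp: "group (rat_seq_group\<lparr>carrier := G\<rparr>)"
    using G comm by (intro subgroup.subgroup_is_group) (simp_all add: comm_group_def)
  show HG: "H \<subseteq> G"
    using subgroup.subset[OF H] by simp
  have neg: "- y \<in> H" if y: "y \<in> H" for y
  proof -
    define z where "z = inv\<^bsub>rat_seq_group\<lparr>carrier := G\<rparr>\<^esub> y"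
    have "z \<in> H"
      unfolding z_def by (rule subgroup.m_inv_closed[OF H y])
    have "z \<otimes>\<^bsub>rat_seq_group\<lparr>carrier := G\<rparr>\<^esub> y = \<one>\<^bsub>rat_seq_group\<lparr>carrier := G\<rparr>\<^esub>"
      unfolding z_def using y HG by (intro group.l_inv[OF grp]) auto
    then have "z = - y"
      by (simp add: rat_seq_group_def eq_neg_iff_add_eq_0)
    then show ?thesis
      using \<open>z \<in> H\<close> by simp
  qed
  show "sequences.zmodule H"
    unfolding sequences.zmodule_def
  proof (intro conjI ballI)
    show "0 \<in> H"
      using subgroup.one_closed[OF H] by (simp add: rat_seq_group_def)
    fix x y assume "x \<in> H" "y \<in> H"
    then show "x - y \<in> H"
      using subgroup.m_closed[OF H _ neg, of x y] by (simp add: rat_seq_group_def)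
  qed
qed

lemma carrier_zmodule:
  assumes "subgroup G rat_seq_group"
  shows "sequences.zmodule G"
proof -
  have "group rat_seq_group"
    using comm_group_rat_seq_group by (rule comm_group.axioms(2))
  then have "subgroup G (rat_seq_group\<lparr>carrier := UNIV\<rparr>)"
    using assms by (simp add: rat_seq_group_def)
  moreover have "subgroup UNIV rat_seq_group"
    using group.subgroup_self[OF \<open>group rat_seq_group\<close>] by (simp add: rat_seq_group_def)
  ultimately show ?thesis
    using subgroup_zmodule(2) by blast
qed

lemma summand_decomposition:
  assumes G: "subgroup G rat_seq_group" and H: "direct_summand H (rat_seq_group\<lparr>carrier := G\<rparr>)"
  shows "H \<subseteq> G \<and> sequences.zmodule H \<and> (\<exists>K. sequences.zmodule K \<and> H \<inter> K = {0} \<and>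
    (\<forall>g\<in>G. \<exists>h\<in>H. \<exists>k\<in>K. g = h + k))"
proof -
  obtain K where K: "subgroup H (rat_seq_group\<lparr>carrier := G\<rparr>)"
    "subgroup K (rat_seq_group\<lparr>carrier := G\<rparr>)"
    "H <#>\<^bsub>rat_seq_group\<lparr>carrier := G\<rparr>\<^esub> K = carrier (rat_seq_group\<lparr>carrier := G\<rparr>)"
    "H \<inter> K = {\<one>\<^bsub>rat_seq_group\<lparr>carrier := G\<rparr>\<^esub>}"
    using H unfolding direct_summand_def by blast
  have "\<forall>g\<in>G. \<exists>h\<in>H. \<exists>k\<in>K. g = h + k"
    using K(3) by (auto simp: set_mult_def rat_seq_group_def)
  moreover have "H \<inter> K = {0}"
    using K(4) by (simp add: rat_seq_group_def)
  ultimately show ?thesis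
    using subgroup_zmodule[OF G K(1)] subgroup_zmodule[OF G K(2)] by blast
qed

text \<open>Every class is that of the representative which \<open>inv_into\<close> selects for its
  code, so there are at most as many classes as codes.\<close>

lemma finite_quotient_by_code:
  assumes "finite (c ` S)" "equiv S R"
    and "\<And>x y. x \<in> S \<Longrightarrow> y \<in> S \<Longrightarrow> c x = c y \<Longrightarrow> (x, y) \<in> R"
  shows "finite (S // R)"
proof -
  have "S // R \<subseteq> (\<lambda>k. R `` {inv_into S c k}) ` c ` S"
  proof
    fix Q assume "Q \<in> S // R"
    then obtain x where x: "x \<in> S" "Q = R `` {x}"
      by (auto elim: quotientE)
    have "inv_into S c (c x) \<in> S" "c (inv_into S c (c x)) = c x"
      using x(1) by (simp_all add: inv_into_into f_inv_into_f)
    then have "(inv_into S c (c x), x) \<in> R"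
      using assms(3) x(1) by blast
    then have "Q = R `` {inv_into S c (c x)}"
      using x(2) equiv_class_eq[OF assms(2)] by blast
    then show "Q \<in> (\<lambda>k. R `` {inv_into S c k}) ` c ` S"
      using x(1) by blast
  qed
  then show ?thesis
    using assms(1) finite_subset by blast
qed

theorem corollary6p5:
  fixes G :: "(nat \<Rightarrow> rat) set"
  assumes "subgroup G rat_seq_group"
    and "finite_rank G"
  shows "finite (direct_summands (rat_seq_group\<lparr>carrier := G\<rparr>) //
                 summand_iso_rel (rat_seq_group\<lparr>carrier := G\<rparr>))"
proof -
  define \<G> where "\<G> = rat_seq_group\<lparr>carrier := G\<rparr>"
  obtain B where B: "finite B" "B \<subseteq> G" "rat_seq.independent B" "G \<subseteq> rat_seq.span B"
    using assms(2) unfolding finite_rank_def by blast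
  obtain P :: "(nat \<Rightarrow> rat) endo"
    where P: "\<And>b. b \<in> B \<Longrightarrow> app P b = b" "\<And>x. app P x \<in> rat_seq.span ((\<lambda>b. b) ` B)"
    using sequences.endo_of_basis[OF B(3), of "\<lambda>b. b"] by blast
  interpret finite_rank_group "\<lambda>(q::rat) (x::nat \<Rightarrow> rat) n. q * x n" G B P
    by unfold_locales (fact carrier_zmodule[OF assms(1)] B P(1) P(2)[unfolded image_ident])+
  obtain code :: "(nat \<Rightarrow> rat) set \<Rightarrow> (nat \<Rightarrow> rat) endo list \<times> (nat \<Rightarrow> rat) endo list set"
    where fin: "finite (code ` {H. splits H})"
      and code: "\<And>H K. splits H \<Longrightarrow> splits K \<Longrightarrow> code H = code K \<Longrightarrow> \<exists>a. bij_betw (app a) H K"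
    using splitting_classes by blast
  have splits: "splits H" if "H \<in> direct_summands \<G>" for H
    unfolding splits_def
    by (rule summand_decomposition[OF assms(1)])
      (use that in \<open>simp add: \<G>_def direct_summands_def\<close>)
  have iso: "(H, K) \<in> summand_iso_rel \<G>"
    if H: "H \<in> direct_summands \<G>" and K: "K \<in> direct_summands \<G>" and eq: "code H = code K" for H K
  proof -
    obtain a :: "(nat \<Rightarrow> rat) endo" where a: "bij_betw (app a) H K"
      using code[OF splits[OF H] splits[OF K] eq] by blast
    \<comment> \<open>\<open>app a\<close> is additive on the whole space, so a bijection between
      the summands is already an isomorphism of groups.\<close>
    have "app a \<in> iso (\<G>\<lparr>carrier := H\<rparr>) (\<G>\<lparr>carrier := K\<rparr>)"
    proof (intro isoI homI)
      fix x y
      show "app a x \<in> carrier (\<G>\<lparr>carrier := K\<rparr>)" if "x \<in> carrier (\<G>\<lparr>carrier := H\<rparr>)"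
        using bij_betwE[OF a] that unfolding \<G>_def by simp
      have "app a (x + y) = app a x + app a y"
        by (rule app_add)
      then show "app a (x \<otimes>\<^bsub>\<G>\<lparr>carrier := H\<rparr>\<^esub> y) = app a x \<otimes>\<^bsub>\<G>\<lparr>carrier := K\<rparr>\<^esub> app a y"
        unfolding \<G>_def rat_seq_group_def by simp
      show "bij_betw (app a) (carrier (\<G>\<lparr>carrier := H\<rparr>)) (carrier (\<G>\<lparr>carrier := K\<rparr>))"
        using a unfolding \<G>_def by simp
    qed
    then show ?thesis
      using H K unfolding summand_iso_rel_def is_iso_def by blast
  qed
  have "code ` direct_summands \<G> \<subseteq> code ` {H. splits H}"
    using splits by blast
  then have fin': "finite (code ` direct_summands \<G>)"
    using fin by (rule finite_subset)
  have "group \<G>"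
    unfolding \<G>_def using assms(1) comm_group_rat_seq_group
    by (intro subgroup.subgroup_is_group) (simp_all add: comm_group_def)
  then have eqv: "equiv (direct_summands \<G>) (summand_iso_rel \<G>)"
    by (rule equiv_summand_iso_rel)
  have "finite (direct_summands \<G> // summand_iso_rel \<G>)"
    by (rule finite_quotient_by_code[OF fin' eqv iso])
  then show ?thesis
    unfolding \<G>_def .
qed

end
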